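(* Let $\mathcal{A}$ be a finite alphabet, $F:\mathcal{A}^{\mathbb{Z}}\to\mathcal{A}^{\mathbb{Z}}$ a cellular automaton and $\mu\in\mathcal{M}_\sigma(\mathcal{A}^{\mathbb{Z}})$ a computable measure. Then $\mathcal{V}(F,\mu)$ and $\mathcal{V}'(F,\mu)$ are nonempty $\Pi_2$-computable compact sets.
   Context: $\mathcal{A}^{\mathbb{Z}}$ carries the product topology, $\mathcal{A}^{*}$ is the set of finite words, $\sigma(x)_i=x_{i+1}$ is the shift, and for a word $u$, $[u]=\{x: x_0\cdots x_{|u|-1}=u\}$. $\mathcal{M}_\sigma(\mathcal{A}^{\mathbb{Z}})$ is the set of $\sigma$-invariant Borel probability measures with the weak$^*$ topology, metrised by $d_{\mathcal{M}}(\mu,\nu)=\sum_{n\in\mathbb{N}}2^{-n}\max_{u\in\mathcal{A}^n}|\mu([u])-\nu([u])|$. A cellular automaton is a continuous map $F:\mathcal{A}^{\mathbb{Z}}\to\mathcal{A}^{\mathbb{Z}}$ commuting with $\sigma$; $F_*\mu(E)=\mu(F^{-1}(E))$. $\mathcal{V}(F,\mu)$ is the set of weak$^*$ limit points of $(F_*^t\mu)_{t\in\mathbb{N}}$, and $\mathcal{V}'(F,\mu)$ is the set of weak$^*$ limit points of $\left(\frac1{t+1}\sum_{i=0}^tF_*^i\mu\right)_{t\in\mathbb{N}}$. A measure $\mu$ is computable if there is a computable $f:\mathcal{A}^*\times\mathbb{N}\to\mathbb{Q}$ with $|\mu([u])-f(u,n)|<2^{-n}$ for all $u\in\mathcal{A}^*$,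 $n\in\mathbb{N}$. For a nonempty word $w$, $\widehat{\delta_w}=\frac1{|w|}\sum_{i=0}^{|w|-1}\delta_{\sigma^i({}^\infty w^\infty)}$ is the measure supported by the orbit of the periodic configuration ${}^\infty w^\infty$. $\overline{\mathbf{B}(\mu,r)}$ denotes the closed $d_{\mathcal{M}}$-ball. A closed set $\mathcal{K}\subset\mathcal{M}_\sigma(\mathcal{A}^{\mathbb{Z}})$ is $\Pi_2$-computable if the characteristic function of $\{(w,r)\in\mathcal{A}^*\times\mathbb{Q}:\overline{\mathbf{B}(\widehat{\delta_w},r)}\cap\mathcal{K}\neq\emptyset\}$ can be written as $\inf_{i}\sup_{j}f_{i,j}$ where $(i,j,w,r)\mapsto f_{i,j}(w,r)$ is computable. *)

theory Defs
  imports "HOL-Probability.Probability"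
begin

section \<open>Recursive functions\<close>

text \<open>Partial recursive functions. \<open>rec_eval p xs y\<close> means that the program \<open>p\<close>
  halts on the argument tuple \<open>xs\<close> with value \<open>y\<close>. Recursion and minimization act on the first
  argument.\<close>

datatype recf = Zero | Succ | Proj nat | Comp recf "recf list" | Prec recf recf | Mu recf

inductive rec_eval :: "recf \<Rightarrow> nat list \<Rightarrow> nat \<Rightarrow> bool" where
  zero: "rec_eval Zero xs 0"
| succ: "rec_eval Succ [x] (Suc x)"
| proj: "i < length xs \<Longrightarrow> rec_eval (Proj i) xs (xs ! i)"
| comp: "list_all2 (\<lambda>g y. rec_eval g xs y) gs ys \<Longrightarrow> rec_eval f ys z \<Longrightarrow> rec_eval (Comp f gs) xs z"
| prec_0: "rec_eval f xs z \<Longrightarrow> rec_eval (Prec f g) (0 # xs) z"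
| prec_Suc: "rec_eval (Prec f g) (n # xs) y \<Longrightarrow> rec_eval g (n # y # xs) z
    \<Longrightarrow> rec_eval (Prec f g) (Suc n # xs) z"
| mu: "rec_eval f (n # xs) 0 \<Longrightarrow> (\<forall>m<n. \<exists>k. rec_eval f (m # xs) (Suc k))
    \<Longrightarrow> rec_eval (Mu f) xs n"

inductive_cases rec_eval_ZeroE: "rec_eval Zero xs y"
inductive_cases rec_eval_SuccE: "rec_eval Succ xs y"
inductive_cases rec_eval_ProjE: "rec_eval (Proj i) xs y"
inductive_cases rec_eval_CompE: "rec_eval (Comp f gs) xs y"
inductive_cases rec_eval_Prec0E: "rec_eval (Prec f g) (0 # xs) y"
inductive_cases rec_eval_PrecSucE: "rec_eval (Prec f g) (Suc n # xs) y"
inductive_cases rec_eval_MuE: "rec_eval (Mu f) xs y"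

lemma rec_eval_deterministic:
  "rec_eval p xs y \<Longrightarrow> rec_eval p xs y' \<Longrightarrow> y = y'"
proof (induction arbitrary: y' rule: rec_eval.induct)
  case (zero xs)
  then show ?case by (rule rec_eval_ZeroE) simp
next
  case (succ x)
  then show ?case by (rule rec_eval_SuccE) simp
next
  case (proj i xs)
  from proj.prems show ?case by (rule rec_eval_ProjE) simp
next
  case (comp xs gs ys f z)
  from comp.prems obtain ys'
    where ys': "list_all2 (\<lambda>g y. rec_eval g xs y) gs ys'" "rec_eval f ys' y'"
    by (rule rec_eval_CompE)
  have "ys = ys'"
    using comp.IH(1) ys'(1) by (auto simp: list_all2_conv_all_nth intro!: nth_equalityI)
  with ys' comp.IH show ?case by blast
next
  case (prec_0 f xs z g)
  from prec_0.prems have "rec_eval f xs y'" by (rule rec_eval_Prec0E)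
  then show ?case by (rule prec_0.IH)
next
  case (prec_Suc f g n xs y z)
  from prec_Suc.prems obtain v where v: "rec_eval (Prec f g) (n # xs) v" "rec_eval g (n # v # xs) y'"
    by (rule rec_eval_PrecSucE)
  from prec_Suc.IH(1)[OF v(1)] v(2) show ?case by (intro prec_Suc.IH(2)) simp
next
  case (mu f n xs)
  from mu.prems have *: "rec_eval f (y' # xs) 0" "\<forall>m<y'. \<exists>k. rec_eval f (m # xs) (Suc k)"
    by (auto elim: rec_eval_MuE)
  show ?case
  proof (rule linorder_cases[of n y'])
    assume "n < y'"
    then obtain k where "rec_eval f (n # xs) (Suc k)" using *(2) by blast
    from mu.IH(1)[OF this] show ?thesis by simp
  next
    assume "y' < n"
    then obtain k where "\<forall>z. rec_eval f (y' # xs) z \<longrightarrow> Suc k = z" using mu.IH(2) by blast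
    with *(1) show ?thesis by blast
  qed
qed

text \<open>The numbering of the letters is an arbitrary injection; as the alphabet is finite, all
  choices give the same computable functions.\<close>

definition word_code :: "'a::finite list \<Rightarrow> nat" where
  "word_code u = list_encode (map to_nat u)"

definition rat_code :: "rat \<Rightarrow> nat" where
  "rat_code q = (case quotient_of q of (a, b) \<Rightarrow> prod_encode (int_encode a, nat b))"

section \<open>Configurations, cellular automata, and invariant measures\<close>

text \<open>The type \<^typ>\<open>int \<Rightarrow> 'a\<close> carries the product topology of the library, here with
  the discrete topology on the finite alphabet.\<close>

definition shift :: "(int \<Rightarrow> 'a) \<Rightarrow> int \<Rightarrow> 'a" where
  "shift x = (\<lambda>i. x (i + 1))"

definition cylinder :: "'a list \<Rightarrow> (int \<Rightarrow> 'a) set" where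
  "cylinder u = {x. \<forall>i<length u. x (int i) = u ! i}"

definition cellular_automaton ::
  "((int \<Rightarrow> 'a::{finite,discrete_topology}) \<Rightarrow> (int \<Rightarrow> 'a)) \<Rightarrow> bool" where
  "cellular_automaton F \<longleftrightarrow> continuous_on UNIV F \<and> (\<forall>x. F (shift x) = shift (F x))"

definition invariant_measures :: "(int \<Rightarrow> 'a::{finite,discrete_topology}) measure set" where
  "invariant_measures =
     {\<mu>. prob_space \<mu> \<and> sets \<mu> = sets borel \<and> distr \<mu> borel shift = \<mu>}"

definition weak_star :: "(int \<Rightarrow> 'a::{finite,discrete_topology}) measure topology" where
  "weak_star = topology_generated_by
     {{\<mu> \<in> invariant_measures. (\<integral>x. g x \<partial>\<mu>) \<in> U} | (g :: (int \<Rightarrow> 'a) \<Rightarrow> real) U.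
        continuous_on UNIV g \<and> open U}"

lemma topspace_weak_star [simp]: "topspace weak_star = invariant_measures"
proof
  show "topspace weak_star \<subseteq> invariant_measures"
    by (auto simp: weak_star_def topology_generated_by_topspace)
  have "continuous_on UNIV (\<lambda>_ :: int \<Rightarrow> 'a. 0 :: real)" by simp
  then show "(invariant_measures :: (int \<Rightarrow> 'a) measure set) \<subseteq> topspace weak_star"
    unfolding weak_star_def topology_generated_by_topspace using open_UNIV by blast
qed

definition measure_dist ::
  "(int \<Rightarrow> 'a::{finite,discrete_topology}) measure \<Rightarrow> (int \<Rightarrow> 'a) measure \<Rightarrow> real" where
  "measure_dist \<mu> \<nu> =
     (\<Sum>n. (1/2) ^ n * (MAX u\<in>{u. length u = n}. \<bar>measure \<mu> (cylinder u) - measure \<nu> (cylinder u)\<bar>))"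

definition average_measure ::
  "nat \<Rightarrow> (nat \<Rightarrow> (int \<Rightarrow> 'a::{finite,discrete_topology}) measure) \<Rightarrow> (int \<Rightarrow> 'a) measure" where
  "average_measure n M =
     measure_of UNIV (sets borel) (\<lambda>E. (\<Sum>i<n. emeasure (M i) E) / of_nat n)"

lemma emeasure_average_measure:
  assumes "\<And>i. i < n \<Longrightarrow> sets (M i) = sets borel" and E: "E \<in> sets borel"
  shows "emeasure (average_measure n M) E = (\<Sum>i<n. emeasure (M i) E) / of_nat n"
  unfolding average_measure_def
proof (rule emeasure_measure_of_sigma)
  show "sigma_algebra UNIV (sets (borel :: (int \<Rightarrow> 'a) measure))"
    using sets.sigma_algebra_axioms[of "borel :: (int \<Rightarrow> 'a) measure"] by simp
  show "positive (sets borel) (\<lambda>E. (\<Sum>i<n. emeasure (M i) E) / of_nat n)"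
    by (simp add: positive_def)
  show "countably_additive (sets borel) (\<lambda>E. (\<Sum>i<n. emeasure (M i) E) / of_nat n)"
  proof (rule countably_additiveI)
    fix A :: "nat \<Rightarrow> (int \<Rightarrow> 'a) set"
    assume A: "range A \<subseteq> sets borel" "disjoint_family A"
    have "(\<Sum>k. (\<Sum>i<n. emeasure (M i) (A k)) / of_nat n)
        = (\<Sum>k. \<Sum>i<n. emeasure (M i) (A k)) / of_nat n"
      by (simp add: divide_ennreal_def)
    also have "(\<Sum>k. \<Sum>i<n. emeasure (M i) (A k)) = (\<Sum>i<n. \<Sum>k. emeasure (M i) (A k))"
      by (rule suminf_sum) simp
    also have "\<dots> = (\<Sum>i<n. emeasure (M i) (\<Union> (range A)))"
      using A assms(1) by (intro sum.cong refl suminf_emeasure) auto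
    finally show "(\<Sum>k. (\<Sum>i<n. emeasure (M i) (A k)) / of_nat n)
        = (\<Sum>i<n. emeasure (M i) (\<Union> (range A))) / of_nat n" .
  qed
qed (rule E)

definition periodic_config :: "'a list \<Rightarrow> int \<Rightarrow> 'a" where
  "periodic_config w = (\<lambda>i. w ! nat (i mod int (length w)))"

definition periodic_measure ::
  "'a::{finite,discrete_topology} list \<Rightarrow> (int \<Rightarrow> 'a) measure" where
  "periodic_measure w =
     average_measure (length w) (\<lambda>i. return borel ((shift ^^ i) (periodic_config w)))"

section \<open>Limit measures\<close>

definition pushforward ::
  "((int \<Rightarrow> 'a::{finite,discrete_topology}) \<Rightarrow> (int \<Rightarrow> 'a)) \<Rightarrow> (int \<Rightarrow> 'a) measure \<Rightarrow> (int \<Rightarrow> 'a) measure" where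
  "pushforward F \<mu> = distr \<mu> borel F"

text \<open>Limit points of a sequence are the limits of its subsequences; they need not be
  accumulation points of its range.\<close>

definition sequence_limit_points :: "'b topology \<Rightarrow> (nat \<Rightarrow> 'b) \<Rightarrow> 'b set" where
  "sequence_limit_points T x =
     {l. \<exists>r :: nat \<Rightarrow> nat. strict_mono r \<and> limitin T (x \<circ> r) l sequentially}"

definition limit_measures ::
  "((int \<Rightarrow> 'a::{finite,discrete_topology}) \<Rightarrow> (int \<Rightarrow> 'a)) \<Rightarrow> (int \<Rightarrow> 'a) measure \<Rightarrow> (int \<Rightarrow> 'a) measure set" where
  "limit_measures F \<mu> = sequence_limit_points weak_star (\<lambda>t. (pushforward F ^^ t) \<mu>)"

definition cesaro_limit_measures ::
  "((int \<Rightarrow> 'a::{finite,discrete_topology}) \<Rightarrow> (int \<Rightarrow> 'a)) \<Rightarrow> (int \<Rightarrow> 'a) measure \<Rightarrow> (int \<Rightarrow> 'a) measure set" where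
  "cesaro_limit_measures F \<mu> =
     sequence_limit_points weak_star (\<lambda>t. average_measure (t + 1) (\<lambda>i. (pushforward F ^^ i) \<mu>))"

section \<open>Computability of measures and of closed sets of measures\<close>

definition computable_measure :: "(int \<Rightarrow> 'a::{finite,discrete_topology}) measure \<Rightarrow> bool" where
  "computable_measure \<mu> \<longleftrightarrow>
     (\<exists>f :: 'a list \<Rightarrow> nat \<Rightarrow> rat.
        (\<exists>p. \<forall>u n. rec_eval p [word_code u, n] (rat_code (f u n))) \<and>
        (\<forall>u n. \<bar>measure \<mu> (cylinder u) - of_rat (f u n)\<bar> < (1/2) ^ n))"

text \<open>There is no measure of the empty word, so the set below contains only pairs with
  nonempty \<open>w\<close>. The infima and suprema are taken in the extended reals, where they always exist.\<close>

definition ball_hits ::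
  "(int \<Rightarrow> 'a::{finite,discrete_topology}) measure set \<Rightarrow> ('a list \<times> rat) set" where
  "ball_hits K =
     {(w, r). w \<noteq> [] \<and>
        {\<nu> \<in> invariant_measures. measure_dist (periodic_measure w) \<nu> \<le> of_rat r} \<inter> K \<noteq> {}}"

definition Pi2_computable :: "(int \<Rightarrow> 'a::{finite,discrete_topology}) measure set \<Rightarrow> bool" where
  "Pi2_computable K \<longleftrightarrow> closedin weak_star K \<and>
     (\<exists>f :: nat \<Rightarrow> nat \<Rightarrow> 'a list \<Rightarrow> rat \<Rightarrow> rat.
        (\<exists>p. \<forall>i j w r. rec_eval p [i, j, word_code w, rat_code r] (rat_code (f i j w r))) \<and>
        (\<forall>w r. indicator (ball_hits K) (w, r) = (INF i. SUP j. ereal (of_rat (f i j w r)))))"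

end

(* Cylinder probabilities metrise the weak topology on the invariant measures, and the space is
   compact: a subsequence along which all cylinder probabilities converge defines a content on the
   clopen sets, which Caratheodory's theorem extends to an invariant measure. Hence the limit points
   of a sequence of invariant measures nu_t form a nonempty compact set, which meets the closed ball
   of radius r around c iff for every i there is t >= i such that d(c, nu_t) <= r up to an error e_i,
   where e_i is any null sequence. If the cylinder probabilities of nu_t are computable uniformly in
   t, then d(c, nu_t) for a periodic measure c can be computed up to e_i, so the condition becomes
   "for all i there is j" in front of a decidable relation.

   The cylinder probabilities of the t-th image of mu are finite sums of cylinder probabilities of mu,
   since t steps of the automaton map words of length n + 2tR to words of length n; the error
   estimate passes to Cesaro means. *)

theory Submission
  imports Defs
begin

text \<open>Comparing a computed real with \<open>r\<close> is undecidable in general, so no single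
  precision settles whether a ball contains a limit point. The test at each precision therefore
  carries a slack of twice its own error. With it, a limit point in the ball makes every precision
  succeed at some late time; conversely the slack tends to 0, and compactness turns successes at all
  precisions into a limit point at distance at most \<open>r\<close>. No quantifier over measures
  survives.

  Computation stays inside the natural numbers. A word of length n is a number below q^n, where q is
  the number of letters, so sums and maxima over words run over initial segments and primitive
  recursion suffices. A probability is a natural number in units of 2^-p, wrong by a bounded number
  of units; a rounded division costs one unit. Apart from the outputs 0 and 1, codes of rationals
  are only read.

  The metric sees only words that start at position 0. Invariance makes this enough: it moves blocks
  to any position, which supplies the two-sided windows of continuous functions and absorbs the
  displacement caused by the automaton, whose known image blocks begin R cells further right after
  each step.\<close>

section \<open>Recursive functions as computable maps between environments\<close>

text \<open>A program receives the values \<open>gs\<close> of an abstract environment. Closure under composition is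
  then transitivity, and a bound variable, as in a sum, is handled by pairing it with the
  environment.\<close>

definition computable_from :: "('e \<Rightarrow> nat) list \<Rightarrow> ('e \<Rightarrow> nat) \<Rightarrow> bool" where
  "computable_from gs h \<longleftrightarrow> (\<exists>p. \<forall>e. rec_eval p (map (\<lambda>g. g e) gs) (h e))"

named_theorems computable

lemma computable_from_member:
  assumes "h \<in> set gs"
  shows "computable_from gs h"
proof -
  obtain i where i: "i < length gs" "gs ! i = h"
    using assms by (auto simp: in_set_conv_nth)
  have "rec_eval (Proj i) (map (\<lambda>g. g e) gs) (h e)" for e
    using rec_eval.proj[of i "map (\<lambda>g. g e) gs"] i by simp
  then show ?thesis by (auto simp: computable_from_def)
qed

lemma computable_from_trans:
  assumes "\<And>g. g \<in> set gs \<Longrightarrow> computable_from fs g" and "computable_from gs h"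
  shows "computable_from fs h"
proof -
  have "\<forall>g\<in>set gs. \<exists>p. \<forall>e. rec_eval p (map (\<lambda>g. g e) fs) (g e)"
    using assms(1) by (simp add: computable_from_def)
  then obtain q where q: "\<And>g e. g \<in> set gs \<Longrightarrow> rec_eval (q g) (map (\<lambda>g. g e) fs) (g e)"
    by metis
  obtain p where p: "\<And>e. rec_eval p (map (\<lambda>g. g e) gs) (h e)"
    using assms(2) by (auto simp: computable_from_def)
  have "rec_eval (Comp p (map q gs)) (map (\<lambda>g. g e) fs) (h e)" for e
    by (rule rec_eval.comp[OF _ p]) (simp add: list.rel_map list.rel_refl_strong q)
  then show ?thesis by (auto simp: computable_from_def)
qed

text \<open>A program sees only the list of values, so \<open>\<phi>\<close> may be any map between
  environments.\<close>

lemma computable_from_reparam: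
  "computable_from gs h \<Longrightarrow> computable_from (map (\<lambda>g e. g (\<phi> e)) gs) (\<lambda>e. h (\<phi> e))"
  by (fastforce simp: computable_from_def comp_def)

text \<open>A bound variable enlarges the environment. This carries a fact about the old environment
  over to the enlarged one, with \<open>\<phi>\<close> the projection that forgets the new
  components.\<close>

lemma computable_from_lift:
  assumes "computable_from gs h" and "\<And>g. g \<in> set gs \<Longrightarrow> (\<lambda>e. g (\<phi> e)) \<in> set fs"
  shows "computable_from fs (\<lambda>e. h (\<phi> e))"
  by (rule computable_from_trans[OF _ computable_from_reparam[OF assms(1), of \<phi>]])
    (use assms(2) in \<open>auto intro: computable_from_member\<close>)

lemma computable_from_compose1:
  assumes "computable_from [\<lambda>x. x] f" and "computable_from gs a"
  shows "computable_from gs (\<lambda>e. f (a e))"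
  using computable_from_reparam[OF assms(1), of a] assms(2)
  by (auto intro: computable_from_trans[rotated])

lemma computable_from_compose2:
  assumes "computable_from [fst, snd] (\<lambda>x. f (fst x) (snd x))"
    and "computable_from gs a" "computable_from gs b"
  shows "computable_from gs (\<lambda>e. f (a e) (b e))"
  using computable_from_reparam[OF assms(1), of "\<lambda>e. (a e, b e)"] assms(2,3)
  by (auto intro: computable_from_trans[rotated])

lemma computable_from_compose4:
  assumes "computable_from [\<lambda>(i, j, k, l). i, \<lambda>(i, j, k, l). j, \<lambda>(i, j, k, l). k, \<lambda>(i, j, k, l). l]
      (\<lambda>(i, j, k, l). f i j k l)"
    and "computable_from gs a" "computable_from gs b" "computable_from gs c" "computable_from gs d"
  shows "computable_from gs (\<lambda>e. f (a e) (b e) (c e) (d e))"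
  using computable_from_reparam[OF assms(1), of "\<lambda>e. (a e, b e, c e, d e)"] assms(2-)
  by (auto intro: computable_from_trans[rotated])

lemma computable_const [computable]: "computable_from gs (\<lambda>_. c)"
proof (induction c)
  case 0
  then show ?case using rec_eval.zero by (auto simp: computable_from_def)
next
  case (Suc c)
  then obtain p where p: "\<And>e. rec_eval p (map (\<lambda>g. g e) gs) c"
    by (auto simp: computable_from_def)
  have "rec_eval (Comp Succ [p]) (map (\<lambda>g. g e) gs) (Suc c)" for e
    by (rule rec_eval.comp[OF _ rec_eval.succ]) (simp add: p)
  then show ?case by (auto simp: computable_from_def)
qed

lemma computable_Suc [computable]:
  "computable_from gs a \<Longrightarrow> computable_from gs (\<lambda>e. Suc (a e))"
  by (rule computable_from_compose1[of Suc])
    (auto simp: computable_from_def intro: exI[of _ Succ] rec_eval.succ)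

lemma computable_rec_nat [computable]:
  assumes b: "computable_from gs b" and z: "computable_from gs z"
    and s: "computable_from (fst # (\<lambda>x. fst (snd x)) # map (\<lambda>g x. g (snd (snd x))) gs)
      (\<lambda>x. s (fst x) (fst (snd x)) (snd (snd x)))"
  shows "computable_from gs (\<lambda>e. rec_nat (z e) (\<lambda>n y. s n y e) (b e))"
proof -
  let ?args = "\<lambda>e. map (\<lambda>g. g e) gs"
  obtain pb where pb: "\<And>e. rec_eval pb (?args e) (b e)"
    using b by (auto simp: computable_from_def)
  obtain pz where pz: "\<And>e. rec_eval pz (?args e) (z e)"
    using z by (auto simp: computable_from_def)
  obtain ps where ps: "\<And>n y e. rec_eval ps (n # y # ?args e) (s n y e)"
    using s by (auto simp: computable_from_def comp_def)
  have rec: "rec_eval (Prec pz ps) (n # ?args e) (rec_nat (z e) (\<lambda>n y. s n y e) n)" for n e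
    by (induction n) (auto intro: rec_eval.prec_0 rec_eval.prec_Suc pz ps)
  \<comment> \<open>\<open>Prec\<close> recurses on its first argument, so the bound is computed
    first and put in front of the old arguments, which the projections pass on unchanged.\<close>
  have "rec_eval (Comp (Prec pz ps) (pb # map Proj [0..<length gs])) (?args e)
      (rec_nat (z e) (\<lambda>n y. s n y e) (b e))" for e
  proof (rule rec_eval.comp[OF _ rec])
    have "rec_eval (Proj i) (?args e) (?args e ! i)" if "i < length gs" for i
      using that by (intro rec_eval.proj) simp
    then have "list_all2 (\<lambda>g y. rec_eval g (?args e) y) (map Proj [0..<length gs]) (?args e)"
      by (auto simp: list_all2_conv_all_nth)
    then show "list_all2 (\<lambda>g y. rec_eval g (?args e) y) (pb # map Proj [0..<length gs]) (b e # ?args e)"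
      by (simp add: pb)
  qed
  then show ?thesis by (auto simp: computable_from_def)
qed

section \<open>Arithmetic operations and decidable relations\<close>

lemma computable_add [computable]:
  assumes "computable_from gs a" "computable_from gs b"
  shows "computable_from gs (\<lambda>e. a e + b e)"
proof -
  have "computable_from gs (\<lambda>e. rec_nat (a e) (\<lambda>n y. Suc y) (b e))"
    by (rule computable assms | (rule computable_from_member, simp; fail))+
  moreover have "rec_nat m (\<lambda>n y. Suc y) k = m + k" for m k by (induction k) auto
  ultimately show ?thesis by simp
qed

lemma computable_diff [computable]:
  assumes "computable_from gs a" "computable_from gs b"
  shows "computable_from gs (\<lambda>e. a e - b e)"
proof -
  \<comment> \<open>A recursion that returns its own counter is the predecessor function; iterating
    it gives truncated subtraction.\<close>
  have *: "rec_nat 0 (\<lambda>n y. n) k = k - 1" for k :: nat by (cases k) auto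
  have "computable_from gs (\<lambda>e. rec_nat (a e) (\<lambda>n y. rec_nat 0 (\<lambda>n y. n) y) (b e))"
    by (rule computable assms | (rule computable_from_member, simp; fail))+
  moreover have "rec_nat m (\<lambda>n y. rec_nat 0 (\<lambda>n y. n) y) k = m - k" for m k
    by (induction k) (auto simp: *)
  ultimately show ?thesis by simp
qed

lemma computable_sum [computable]:
  assumes "computable_from (fst # map (\<lambda>g x. g (snd x)) gs) (\<lambda>x. f (fst x) (snd x))"
    and "computable_from gs b"
  shows "computable_from gs (\<lambda>e. \<Sum>i<b e. f i e)"
proof -
  have "computable_from (fst # (\<lambda>x. fst (snd x)) # map (\<lambda>g x. g (snd (snd x))) gs)
      (\<lambda>x. f (fst x) (snd (snd x)))"
    using computable_from_lift[OF assms(1), of "\<lambda>x. (fst x, snd (snd x))"] by force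
  then have "computable_from gs (\<lambda>e. rec_nat 0 (\<lambda>n y. y + f n e) (b e))"
    by - (rule computable assms | assumption | (rule computable_from_member, simp; fail))+
  moreover have "rec_nat 0 (\<lambda>n y. y + f n e) k = (\<Sum>i<k. f i e)" for k e
    by (induction k) auto
  ultimately show ?thesis by simp
qed

lemma computable_mult [computable]:
  assumes "computable_from gs a" "computable_from gs b"
  shows "computable_from gs (\<lambda>e. a e * b e)"
proof -
  \<comment> \<open>The summand \<open>a e\<close> is evaluated inside the recursion, where counter
    and accumulator precede the environment, so its hypothesis has to be lifted along the projection
    to \<open>e\<close>.\<close>
  have "computable_from gs (\<lambda>e. rec_nat 0 (\<lambda>n y. y + a e) (b e))"
    by (rule computable assms | (rule computable_from_lift[OF assms(1)], force; fail) |
      (rule computable_from_member, simp; fail))+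
  moreover have "rec_nat 0 (\<lambda>n y. y + m) k = m * k" for m k :: nat by (induction k) auto
  ultimately show ?thesis by simp
qed

lemma computable_power [computable]:
  assumes "computable_from gs a" "computable_from gs b"
  shows "computable_from gs (\<lambda>e. a e ^ b e)"
proof -
  have "computable_from gs (\<lambda>e. rec_nat 1 (\<lambda>n y. y * a e) (b e))"
    by (rule computable assms | (rule computable_from_lift[OF assms(1)], force; fail) |
      (rule computable_from_member, simp; fail))+
  moreover have "rec_nat 1 (\<lambda>n y. y * m) k = m ^ k" for m k :: nat by (induction k) auto
  ultimately show ?thesis by simp
qed

lemma computable_not [computable]:
  assumes "computable_from gs (\<lambda>e. of_bool (P e))"
  shows "computable_from gs (\<lambda>e. of_bool (\<not> P e))"
proof -
  have "computable_from gs (\<lambda>e. 1 - of_bool (P e))"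
    by (rule computable_diff computable_const assms)+
  moreover have "1 - of_bool p = (of_bool (\<not> p) :: nat)" for p by simp
  ultimately show ?thesis by simp
qed

lemma computable_conj [computable]:
  assumes "computable_from gs (\<lambda>e. of_bool (P e))" "computable_from gs (\<lambda>e. of_bool (Q e))"
  shows "computable_from gs (\<lambda>e. of_bool (P e \<and> Q e))"
  using computable_mult[OF assms] by (simp add: of_bool_conj)

lemma computable_le [computable]:
  assumes "computable_from gs a" "computable_from gs b"
  shows "computable_from gs (\<lambda>e. of_bool (a e \<le> b e))"
proof -
  have "computable_from gs (\<lambda>e. 1 - (a e - b e))"
    by (rule computable_diff computable_const assms)+
  moreover have "1 - (m - k) = of_bool (m \<le> k)" for m k :: nat by auto
  ultimately show ?thesis by simp
qed

lemma computable_eq [computable]: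
  assumes "computable_from gs a" "computable_from gs b"
  shows "computable_from gs (\<lambda>e. of_bool (a e = b e))"
proof -
  have "computable_from gs (\<lambda>e. of_bool (a e \<le> b e \<and> b e \<le> a e))"
    by (rule computable_conj computable_le assms)+
  moreover have "m \<le> n \<and> n \<le> m \<longleftrightarrow> m = n" for m n :: nat by auto
  ultimately show ?thesis by simp
qed

lemma computable_bounded_all [computable]:
  assumes "computable_from (fst # map (\<lambda>g x. g (snd x)) gs) (\<lambda>x. of_bool (P (fst x) (snd x)))"
    and "computable_from gs b"
  shows "computable_from gs (\<lambda>e. of_bool (\<forall>i<b e. P i e))"
proof -
  have "computable_from gs (\<lambda>e. of_bool ((\<Sum>i<b e. of_bool (\<not> P i e)) = (0::nat)))"
    by (rule computable assms)+
  moreover have "(\<Sum>i<b e. of_bool (\<not> P i e)) = (0::nat) \<longleftrightarrow> (\<forall>i<b e. P i e)" for e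
    by (auto simp: sum_eq_0_iff simp del: of_bool_not_iff)
  ultimately show ?thesis by simp
qed

lemma computable_if [computable]:
  assumes "computable_from gs (\<lambda>e. of_bool (P e))" "computable_from gs a" "computable_from gs b"
  shows "computable_from gs (\<lambda>e. if P e then a e else b e)"
proof -
  have "computable_from gs (\<lambda>e. of_bool (P e) * a e + of_bool (\<not> P e) * b e)"
    by (rule computable assms)+
  moreover have "of_bool p * m + of_bool (\<not> p) * n = (if p then m else n)" for p and m n :: nat
    by simp
  ultimately show ?thesis by simp
qed

lemma computable_max [computable]:
  assumes "computable_from gs a" "computable_from gs b"
  shows "computable_from gs (\<lambda>e. max (a e) (b e))"
  unfolding max_def by (rule computable assms)+

lemma computable_div [computable]:
  assumes "computable_from gs a" "computable_from gs b"
  shows "computable_from gs (\<lambda>e. a e div b e)"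
proof -
  \<comment> \<open>The quotient counts the positive multiples of the divisor up to the dividend.
    For divisor 0 every summand would be 1, whereas division by 0 gives 0, hence the case
    distinction.\<close>
  have "computable_from gs (\<lambda>e. if b e = 0 then 0 else \<Sum>i<a e. of_bool (Suc i * b e \<le> a e))"
    by (rule computable assms | (rule computable_from_lift[OF assms(1)], force; fail) |
      (rule computable_from_lift[OF assms(2)], force; fail) |
      (rule computable_from_member, simp; fail))+
  moreover have "(if n = 0 then 0 else \<Sum>i<m. of_bool (Suc i * n \<le> m)) = m div n" for m n :: nat
  proof (cases "n = 0")
    case False
    then have "i < m \<and> Suc i * n \<le> m \<longleftrightarrow> i < m div n" for i
      using less_eq_div_iff_mult_less_eq[of n "Suc i" m] div_le_dividend[of m n]
      unfolding Suc_le_eq by linarith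
    then have "{i. i < m \<and> Suc i * n \<le> m} = {..<m div n}" by auto
    moreover have "(\<Sum>i<m. of_bool (Suc i * n \<le> m)) = card {i. i < m \<and> Suc i * n \<le> m}"
      by (simp add: of_bool_def sum.If_cases lessThan_def Int_def del: mult_Suc)
    ultimately show ?thesis using False by simp
  qed simp
  ultimately show ?thesis by (simp del: mult_Suc)
qed

lemma computable_mod [computable]:
  assumes "computable_from gs a" "computable_from gs b"
  shows "computable_from gs (\<lambda>e. a e mod b e)"
  unfolding minus_div_mult_eq_mod[symmetric] by (rule computable assms)+

text \<open>On finitely many arguments a function is a table that can be written into the program.
  The local rule of the automaton and the numbering of the letters enter in this way.\<close>

lemma computable_finite_table:
  assumes "computable_from gs a" and "\<And>e. a e < (N::nat)"
  shows "computable_from gs (\<lambda>e. h (a e))"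
proof -
  have *: "computable_from gs (\<lambda>e. \<Sum>i<M. h i * of_bool (a e = i))" for M
    by (induction M) (simp, rule computable, simp, (rule computable assms | assumption)+)
  have "(\<Sum>i<N. h i * of_bool (a e = i)) = h (a e)" for e
    using assms(2)[of e] by (simp add: of_bool_def if_distrib cong: if_cong)
  then show ?thesis using *[of N] by simp
qed

section \<open>Codes of pairs and of lists\<close>

lemma computable_prod_encode [computable]:
  assumes "computable_from gs a" "computable_from gs b"
  shows "computable_from gs (\<lambda>e. prod_encode (a e, b e))"
  unfolding prod_encode_def triangle_def prod.case by (rule computable assms)+

lemma fst_le_prod_encode: "m \<le> prod_encode (m, n)"
  and snd_le_prod_encode: "n \<le> prod_encode (m, n)"
  using le_prod_encode_1 le_prod_encode_2 by blast+

text \<open>Both components of a pair are bounded by its code, so a bounded double sum finds the one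
  pair that has the code \<open>c\<close>. This inverts the pairing by sums alone.\<close>

lemma sum_prod_decode:
  "(\<Sum>i<Suc c. \<Sum>j<Suc c. f i j * of_bool (prod_encode (i, j) = c)) =
    (f (fst (prod_decode c)) (snd (prod_decode c)) :: nat)"
proof -
  obtain m n where c: "c = prod_encode (m, n)"
    by (metis prod_decode_inverse surj_pair)
  have le: "m < Suc c" "n < Suc c"
    by (simp_all add: c less_Suc_eq_le fst_le_prod_encode snd_le_prod_encode)
  have "(\<Sum>i<Suc c. \<Sum>j<Suc c. f i j * of_bool (prod_encode (i, j) = c))
      = (\<Sum>i<Suc c. if i = m then \<Sum>j<Suc c. if j = n then f i j else 0 else 0)"
    by (intro sum.cong refl) (auto simp: c prod_encode_eq intro!: sum.cong)
  also have "\<dots> = f m n" using le by (simp only: sum.delta finite_lessThan lessThan_iff if_True)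
  finally show ?thesis by (simp add: c)
qed

lemma computable_prod_decode [computable]:
  assumes "computable_from gs a"
  shows "computable_from gs (\<lambda>e. fst (prod_decode (a e)))"
    and "computable_from gs (\<lambda>e. snd (prod_decode (a e)))"
proof -
  have "computable_from gs (\<lambda>e. \<Sum>i<Suc (a e). \<Sum>j<Suc (a e). i * of_bool (prod_encode (i, j) = a e))"
    by (rule computable assms | (rule computable_from_lift[OF assms], force; fail) |
      (rule computable_from_member, simp; fail))+
  then show "computable_from gs (\<lambda>e. fst (prod_decode (a e)))"
    by (simp only: sum_prod_decode)
  have "computable_from gs (\<lambda>e. \<Sum>i<Suc (a e). \<Sum>j<Suc (a e). j * of_bool (prod_encode (i, j) = a e))"
    by (rule computable assms | (rule computable_from_lift[OF assms], force; fail) |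
      (rule computable_from_member, simp; fail))+
  then show "computable_from gs (\<lambda>e. snd (prod_decode (a e)))"
    by (simp only: sum_prod_decode)
qed

lemma computable_Max [computable]:
  assumes "computable_from (fst # map (\<lambda>g x. g (snd x)) gs) (\<lambda>x. f (fst x) (snd x))"
    and "computable_from gs b" and pos: "\<And>e. 0 < b e"
  shows "computable_from gs (\<lambda>e. MAX i\<in>{..<b e}. f i e)"
proof -
  have "computable_from (fst # (\<lambda>x. fst (snd x)) # map (\<lambda>g x. g (snd (snd x))) gs)
      (\<lambda>x. f (fst x) (snd (snd x)))"
    using computable_from_lift[OF assms(1), of "\<lambda>x. (fst x, snd (snd x))"] by force
  note [computable] = this assms(2)
  \<comment> \<open>Natural numbers have no value below 0, so 0 is a harmless start for the running
    maximum; \<open>pos\<close> keeps the index set nonempty.\<close>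
  have "computable_from gs (\<lambda>e. rec_nat 0 (\<lambda>n y. max (f n e) y) (b e))"
    by (rule computable | (rule computable_from_member, simp; fail))+
  moreover have "rec_nat 0 (\<lambda>n y. max (f n e) y) (Suc k) = (MAX i\<in>{..<Suc k}. f i e)" for k e
    by (induction k) (simp_all add: lessThan_Suc)
  then have "rec_nat 0 (\<lambda>n y. max (f n e) y) (b e) = (MAX i\<in>{..<b e}. f i e)" for e
    by (metis pos Suc_pred)
  ultimately show ?thesis by simp
qed

text \<open>A nonempty list has the code \<open>Suc (prod_encode (x, c))\<close>, hence the
  subtraction of 1. The empty list has code 0, and \<open>prod_decode 0 = (0, 0)\<close> makes it
  its own tail.\<close>

definition code_tl :: "nat \<Rightarrow> nat" where
  "code_tl c = snd (prod_decode (c - 1))"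

lemma code_tl_list_encode: "code_tl (list_encode xs) = list_encode (tl xs)"
proof -
  have "prod_decode 0 = (0, 0)"
    unfolding prod_decode_def by (subst prod_decode_aux.simps) simp
  then show ?thesis by (cases xs) (simp_all add: code_tl_def)
qed

lemma code_tl_funpow: "(code_tl ^^ i) (list_encode xs) = list_encode (drop i xs)"
  by (induction i) (simp_all add: code_tl_list_encode drop_Suc tl_drop)

definition code_nth :: "nat \<Rightarrow> nat \<Rightarrow> nat" where
  "code_nth c i = fst (prod_decode ((code_tl ^^ i) c - 1))"

lemma code_nth_list_encode: "i < length xs \<Longrightarrow> code_nth (list_encode xs) i = xs ! i"
  by (simp add: code_nth_def code_tl_funpow Cons_nth_drop_Suc[symmetric])

text \<open>Only the empty list has code 0, so the nonzero iterated tails are counted. A code is at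
  least the length of its list, which makes \<open>c\<close> a sufficient bound.\<close>

definition code_length :: "nat \<Rightarrow> nat" where
  "code_length c = (\<Sum>i<c. of_bool ((code_tl ^^ i) c \<noteq> 0))"

lemma length_le_list_encode: "length xs \<le> list_encode xs"
proof (induction xs)
  case (Cons x xs)
  then show ?case using snd_le_prod_encode[of "list_encode xs" x] by simp
qed simp

lemma code_length_list_encode: "code_length (list_encode xs) = length xs"
proof -
  have "list_encode ys = 0 \<longleftrightarrow> ys = []" for ys by (cases ys) auto
  then have "code_length (list_encode xs) = card {i. i < list_encode xs \<and> i < length xs}"
    by (simp add: code_length_def code_tl_funpow of_bool_def sum.If_cases lessThan_def Int_def not_le)
  also have "{i. i < list_encode xs \<and> i < length xs} = {..<length xs}"
    using length_le_list_encode[of xs] by auto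
  finally show ?thesis by simp
qed

lemma computable_funpow:
  assumes "computable_from [\<lambda>x. x] f" "computable_from gs a" "computable_from gs b"
  shows "computable_from gs (\<lambda>e. (f ^^ a e) (b e))"
proof -
  note [computable] = assms(2,3) computable_from_compose1[OF assms(1)]
  have "computable_from gs (\<lambda>e. rec_nat (b e) (\<lambda>n y. f y) (a e))"
    by (rule computable | (rule computable_from_member, simp; fail))+
  moreover have "rec_nat m (\<lambda>n y. f y) k = (f ^^ k) m" for m k by (induction k) auto
  ultimately show ?thesis by simp
qed

lemma computable_code_tl_funpow:
  "computable_from gs a \<Longrightarrow> computable_from gs b \<Longrightarrow> computable_from gs (\<lambda>e. (code_tl ^^ a e) (b e))"
  unfolding code_tl_def[abs_def]
  by (rule computable_funpow) (rule computable | assumption | (rule computable_from_member, simp; fail))+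

lemma computable_code_nth [computable]:
  "computable_from gs a \<Longrightarrow> computable_from gs b \<Longrightarrow> computable_from gs (\<lambda>e. code_nth (a e) (b e))"
  unfolding code_nth_def by (rule computable computable_code_tl_funpow | assumption)+

lemma computable_code_length [computable]:
  assumes "computable_from gs a"
  shows "computable_from gs (\<lambda>e. code_length (a e))"
  unfolding code_length_def
  by (rule computable computable_code_tl_funpow assms |
    (rule computable_from_lift[OF assms], force; fail) | (rule computable_from_member, simp; fail))+

section \<open>Words coded as numbers\<close>

text \<open>Expansions in base \<open>CARD('a)\<close> need every smaller number to be a letter. The
  coding \<open>to_nat\<close> is only known to be injective, so a bijection onto an initial segment
  is chosen instead.\<close>

definition digit :: "'a::finite \<Rightarrow> nat" where
  "digit = (SOME f. bij_betw f UNIV {..<CARD('a)})"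

definition letter :: "nat \<Rightarrow> 'a::finite" where
  "letter = inv_into UNIV digit"

lemma bij_betw_digit: "bij_betw (digit :: 'a::finite \<Rightarrow> nat) UNIV {..<CARD('a)}"
  unfolding digit_def
  by (rule someI_ex[where P = "\<lambda>f. bij_betw f UNIV {..<CARD('a)}"])
    (use ex_bij_betw_finite_nat[of "UNIV :: 'a set"] in \<open>simp add: atLeast0LessThan\<close>)

lemma digit_less: "digit (a :: 'a::finite) < CARD('a)"
  using bij_betw_apply[OF bij_betw_digit, of a] by simp

lemma digit_eq_iff: "digit (a :: 'a::finite) = digit b \<longleftrightarrow> a = b"
  using bij_betw_digit[where 'a='a] by (auto simp: bij_betw_def inj_eq)

lemma digit_letter: "i < CARD('a) \<Longrightarrow> digit (letter i :: 'a::finite) = i"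
  unfolding letter_def using bij_betw_digit[where 'a='a] by (simp add: bij_betw_def f_inv_into_f)

text \<open>The leftmost letter is the lowest digit. A prefix is then a remainder modulo a power of
  the base, and dropping letters on the left is a division.\<close>

definition block :: "(int \<Rightarrow> 'a::finite) \<Rightarrow> int \<Rightarrow> nat \<Rightarrow> nat" where
  "block x a n = (\<Sum>i<n. digit (x (a + int i)) * CARD('a) ^ i)"

lemma card_power_pos: "0 < CARD('a::finite) ^ n"
  by (simp add: card_gt_0_iff)

lemma digits_less:
  assumes "\<And>i. i < n \<Longrightarrow> f i < (q::nat)"
  shows "(\<Sum>i<n. f i * q ^ i) < q ^ n"
  using assms
proof (induction n)
  case (Suc n)
  have "(\<Sum>i<n. f i * q ^ i) < q ^ n" using Suc by simp
  moreover have "f n * q ^ n \<le> (q - 1) * q ^ n" using Suc.prems[of n] by (intro mult_right_mono) auto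
  moreover have "q ^ Suc n = q ^ n + (q - 1) * q ^ n" using Suc.prems[of n] by (cases q) auto
  ultimately show ?case unfolding sum.lessThan_Suc by linarith
qed simp

lemma block_less: "block (x :: int \<Rightarrow> 'a::finite) a n < CARD('a) ^ n"
  unfolding block_def by (rule digits_less) (rule digit_less)

lemma digits_add:
  "(\<Sum>i<m + n. f i * q ^ i) = (\<Sum>i<m. f i * q ^ i) + q ^ m * (\<Sum>i<n. f (m + i) * q ^ i)"
  for q :: nat
proof -
  have "(\<Sum>i<m + n. f i * q ^ i) = (\<Sum>i<m. f i * q ^ i) + (\<Sum>i=m..<m + n. f i * q ^ i)"
    by (simp add: lessThan_atLeast0 sum.atLeastLessThan_concat)
  also have "(\<Sum>i=m..<m + n. f i * q ^ i) = (\<Sum>i<n. f (m + i) * q ^ (m + i))"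
    using sum.shift_bounds_nat_ivl[of "\<lambda>i. f i * q ^ i" 0 m n] by (simp add: lessThan_atLeast0 add.commute)
  finally show ?thesis by (simp add: sum_distrib_left power_add ac_simps)
qed

lemma block_add:
  "block (x :: int \<Rightarrow> 'a::finite) a (m + n) = block x a m + CARD('a) ^ m * block x (a + int m) n"
  unfolding block_def by (simp add: digits_add add.assoc)

lemma mod_div_power_mod:
  assumes "i + l \<le> n" "q > 0"
  shows "j div q ^ i mod q ^ l = j mod q ^ n div q ^ i mod (q ^ l :: nat)"
proof -
  obtain d where n: "n = i + (l + d)" using assms le_Suc_ex by (metis add.assoc)
  have "j mod q ^ n div q ^ i = j div q ^ i mod q ^ (l + d)"
    using mod_mult2_eq[of j "q ^ i" "q ^ (l + d)"]
    using assms(2) by (simp add: n power_add div_mult2_eq)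
  then show ?thesis by (simp add: power_add mod_mult2_eq)
qed

text \<open>A factor of a word is read off by a division and a remainder. Only the \<open>n\<close>
  lowest digits of \<open>j\<close> are prescribed, so \<open>j\<close> may carry arbitrary digits
  above them.\<close>

lemma block_div_mod:
  fixes x :: "int \<Rightarrow> 'a::finite"
  assumes "i + l \<le> n" and "j mod CARD('a) ^ n = block x a n"
  shows "j div CARD('a) ^ i mod CARD('a) ^ l = block x (a + int i) l"
proof -
  obtain d where n: "n = i + (l + d)" using assms le_Suc_ex by (metis add.assoc)
  have "block x a n div CARD('a) ^ i = block x (a + int i) (l + d)"
    unfolding n block_add using block_less[of x a i] card_power_pos[of i, where 'a='a] by simp
  then show ?thesis
    using mod_div_power_mod[OF assms(1), of "CARD('a)" j] block_less[of x "a + int i" l]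
    by (simp add: assms(2) block_add)
qed

lemma block_1: "block x a (Suc 0) = digit (x a)"
  by (simp add: block_def)

lemma block_digit:
  fixes x :: "int \<Rightarrow> 'a::finite"
  assumes "i < n"
  shows "block x a n div CARD('a) ^ i mod CARD('a) = digit (x (a + int i))"
  using block_div_mod[of i 1 n "block x a n" x a] assms
  by (simp add: block_less block_1)

lemma block_eq_iff:
  "block (x :: int \<Rightarrow> 'a::finite) a n = block y b n \<longleftrightarrow> (\<forall>i<n. x (a + int i) = y (b + int i))"
proof
  assume eq: "block x a n = block y b n"
  have "digit (x (a + int i)) = digit (y (b + int i))" if "i < n" for i
    using that by (simp only: block_digit[symmetric] eq)
  then show "\<forall>i<n. x (a + int i) = y (b + int i)" by (simp add: digit_eq_iff)
qed (simp add: block_def)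

lemma block_eqI: "(\<And>i. i < n \<Longrightarrow> x (a + int i) = y (b + int i)) \<Longrightarrow> block x a n = block y b n"
  by (simp add: block_eq_iff)

lemma digits_surj:
  fixes k :: nat
  assumes "k < q ^ n"
  shows "(\<Sum>i<n. (k div q ^ i mod q) * q ^ i) = k"
  using assms
proof (induction n arbitrary: k)
  case (Suc n)
  then have "q > 0" by (cases q) auto
  have "(\<Sum>i<n. (k div q ^ i mod q) * q ^ i) = (\<Sum>i<n. (k mod q ^ n div q ^ i mod q) * q ^ i)"
    using mod_div_power_mod[of _ 1 n q k] \<open>q > 0\<close> by (intro sum.cong refl) (simp add: Suc_le_eq)
  also have "\<dots> = k mod q ^ n" using \<open>q > 0\<close> by (intro Suc.IH) simp
  finally have *: "(\<Sum>i<n. (k div q ^ i mod q) * q ^ i) = k mod q ^ n" .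
  have "k div q ^ n < q" using Suc.prems \<open>q > 0\<close> by (simp add: less_mult_imp_div_less)
  then show ?case by (simp add: * mod_div_mult_eq)
qed simp

text \<open>At negative positions \<open>nat\<close> gives 0, which repeats the lowest digit there;
  only positions from 0 on are ever read.\<close>

definition nat_config :: "nat \<Rightarrow> int \<Rightarrow> 'a::finite" where
  "nat_config k i = letter (k div CARD('a) ^ nat i mod CARD('a))"

lemma block_nat_config:
  assumes "k < CARD('a::finite) ^ n"
  shows "block (nat_config k :: int \<Rightarrow> 'a) 0 n = k"
  using digits_surj[OF assms] by (simp add: block_def nat_config_def digit_letter)

definition nat_word :: "nat \<Rightarrow> nat \<Rightarrow> 'a::finite list" where
  "nat_word n k = map (\<lambda>i. nat_config k (int i)) [0..<n]"

lemma length_nat_word [simp]: "length (nat_word n k) = n"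
  by (simp add: nat_word_def)

definition block_set :: "nat \<Rightarrow> nat \<Rightarrow> (int \<Rightarrow> 'a::finite) set" where
  "block_set n k = {x. block x 0 n = k}"

lemma cylinder_nat_word:
  assumes "k < CARD('a::finite) ^ n"
  shows "cylinder (nat_word n k :: 'a list) = block_set n k"
proof -
  have "x \<in> cylinder (nat_word n k) \<longleftrightarrow> block x 0 n = block (nat_config k :: int \<Rightarrow> 'a) 0 n" for x :: "int \<Rightarrow> 'a"
    by (simp add: block_eq_iff cylinder_def nat_word_def)
  then show ?thesis by (auto simp: block_set_def block_nat_config[OF assms])
qed

lemma words_eq_nat_words: "{u :: 'a::finite list. length u = n} = nat_word n ` {..<CARD('a) ^ n}"
proof safe
  fix u :: "'a list"
  define x where "x = (\<lambda>i. u ! nat i)"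
  define k where "k = block x 0 (length u)"
  have k: "k < CARD('a) ^ length u" by (simp add: k_def block_less)
  have "\<forall>i<length u. nat_config k (int i) = x (int i)"
    using block_nat_config[OF k] by (simp add: k_def block_eq_iff)
  then have "u = nat_word (length u) k"
    by (auto simp: nat_word_def x_def intro!: nth_equalityI)
  with k show "u \<in> nat_word (length u) ` {..<CARD('a) ^ length u}" by blast
qed simp

lemma block_shift: "block (shift x) a n = block x (a + 1) n"
  by (simp add: block_def shift_def ac_simps)

lemma funpow_shift: "(shift ^^ m) x = (\<lambda>i. x (i + int m))"
  by (induction m) (auto simp: shift_def ac_simps)

section \<open>Compactness of the configuration space and finite windows\<close>

lemma open_agree: "open {y :: int \<Rightarrow> 'a::{finite,discrete_topology}. \<forall>i\<in>I. y i = x i}" if "finite I"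
proof -
  have "open {y :: int \<Rightarrow> 'a. \<forall>i\<in>I. y i \<in> {x i}}"
    using that product_topology_basis'[of I "\<lambda>i. {x i}" "\<lambda>i. i", OF _ discrete_topology_class.open_discrete]
    by simp
  then show ?thesis by simp
qed

lemma open_contains_agree:
  fixes x :: "int \<Rightarrow> 'a::{finite,discrete_topology}"
  assumes "open U" "x \<in> U"
  obtains L :: nat where "{y. \<forall>i\<in>{-int L..int L}. y i = x i} \<subseteq> U"
proof -
  have "openin (product_topology (\<lambda>i. euclidean) UNIV) U"
    using assms(1) by (simp add: open_fun_def)
  from product_topology_open_contains_basis[OF this assms(2)]
  obtain X where X: "x \<in> Pi\<^sub>E UNIV X" "finite {i. X i \<noteq> UNIV}" "Pi\<^sub>E UNIV X \<subseteq> U"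
    by auto
  obtain L where L: "\<forall>i\<in>{i. X i \<noteq> UNIV}. nat \<bar>i\<bar> \<le> L"
    using finite_nat_set_iff_bounded_le[of "(\<lambda>i. nat \<bar>i\<bar>) ` {i. X i \<noteq> UNIV}"] X(2) by auto
  have "y \<in> Pi\<^sub>E UNIV X" if "\<forall>i\<in>{-int L..int L}. y i = x i" for y
  proof -
    have "y i \<in> X i" for i
    proof (cases "X i = UNIV")
      case False
      then have "nat \<bar>i\<bar> \<le> L" using L by auto
      then have "i \<in> {-int L..int L}" by auto
      with that X(1) show ?thesis by (auto simp: PiE_iff)
    qed simp
    then show ?thesis by (simp add: PiE_iff)
  qed
  with X(3) show ?thesis by (intro that[of L]) auto
qed

lemma compact_configs: "compact (UNIV :: (int \<Rightarrow> 'a::{finite,discrete_topology}) set)"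
proof -
  have "compact_space (euclidean :: 'a topology)"
    by (simp add: compact_space_def compactin_euclidean_iff finite_imp_compact)
  then have "compact_space (product_topology (\<lambda>i::int. euclidean :: 'a topology) UNIV)"
    by (simp add: compact_space_product_topology)
  then show ?thesis
    by (simp add: euclidean_product_topology compact_space_def compactin_euclidean_iff)
qed

text \<open>A Lebesgue number argument. Around each configuration some window forces
  \<open>P\<close>; finitely many of the resulting cylinders cover the space, and the largest of
  their windows works everywhere. The relation \<open>P\<close> lets one argument serve continuous
  functions, clopen sets and the local rule.\<close>

lemma uniform_locality:
  fixes P :: "(int \<Rightarrow> 'a::{finite,discrete_topology}) \<Rightarrow> (int \<Rightarrow> 'a) \<Rightarrow> bool"
  assumes "\<And>x. \<exists>U. open U \<and> x \<in> U \<and> (\<forall>y\<in>U. \<forall>z\<in>U. P y z)"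
  obtains L :: nat where "\<And>x y. (\<And>i. \<bar>i\<bar> \<le> int L \<Longrightarrow> x i = y i) \<Longrightarrow> P x y"
proof -
  have "\<exists>L::nat. \<forall>y z. (\<forall>i\<in>{-int L..int L}. y i = x i) \<longrightarrow> (\<forall>i\<in>{-int L..int L}. z i = x i) \<longrightarrow> P y z" for x
  proof -
    obtain U where U: "open U" "x \<in> U" "\<forall>y\<in>U. \<forall>z\<in>U. P y z" using assms[of x] by blast
    obtain L :: nat where "{y. \<forall>i\<in>{-int L..int L}. y i = x i} \<subseteq> U"
      using open_contains_agree[OF U(1,2)] .
    then have "P y z" if "\<forall>i\<in>{-int L..int L}. y i = x i" "\<forall>i\<in>{-int L..int L}. z i = x i" for y z
      using that U(3) by blast
    then show ?thesis by blast
  qed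
  then have "\<forall>x. \<exists>L::nat. \<forall>y z. (\<forall>i\<in>{-int L..int L}. y i = x i) \<longrightarrow> (\<forall>i\<in>{-int L..int L}. z i = x i) \<longrightarrow> P y z"
    by blast
  from choice[OF this] obtain N :: "(int \<Rightarrow> 'a) \<Rightarrow> nat"
    where N: "\<And>x y z. (\<forall>i\<in>{-int (N x)..int (N x)}. y i = x i) \<Longrightarrow>
      (\<forall>i\<in>{-int (N x)..int (N x)}. z i = x i) \<Longrightarrow> P y z"
    by blast
  define B where "B x = {y. \<forall>i\<in>{-int (N x)..int (N x)}. y i = x i}" for x
  have cover: "UNIV \<subseteq> (\<Union>x\<in>UNIV. B x)" by (auto simp: B_def)
  have "open (B x)" for x unfolding B_def by (rule open_agree) simp
  then obtain C :: "(int \<Rightarrow> 'a) set" where C: "finite C" "UNIV \<subseteq> (\<Union>x\<in>C. B x)"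
    using compactE_image[OF compact_configs _ cover] by metis
  obtain L where L: "\<forall>x\<in>C. N x \<le> L"
    using finite_nat_set_iff_bounded_le[of "N ` C"] C(1) by auto
  show ?thesis
  proof (rule that[of L])
    fix x y :: "int \<Rightarrow> 'a" assume eq: "\<And>i. \<bar>i\<bar> \<le> int L \<Longrightarrow> x i = y i"
    obtain c where c: "c \<in> C" "x \<in> B c" using C(2) by auto
    with L have "N c \<le> L" by auto
    then have "y i = x i" if "i \<in> {-int (N c)..int (N c)}" for i
      using that by (intro eq[symmetric]) auto
    then show "P x y" using c(2) by (intro N[of c]) (auto simp: B_def)
  qed
qed

lemma continuous_uniform_locality:
  fixes g :: "(int \<Rightarrow> 'a::{finite,discrete_topology}) \<Rightarrow> 'b::metric_space"
  assumes "continuous_on UNIV g" "0 < \<epsilon>"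
  obtains L :: nat where "\<And>x y. (\<And>i. \<bar>i\<bar> \<le> int L \<Longrightarrow> x i = y i) \<Longrightarrow> dist (g x) (g y) < \<epsilon>"
proof (rule uniform_locality[of "\<lambda>y z. dist (g y) (g z) < \<epsilon>"])
  fix x
  have "open (g -` ball (g x) (\<epsilon>/2))"
    using assms(1) by (simp add: continuous_on_open_vimage)
  moreover have "dist (g y) (g z) < \<epsilon>" if "y \<in> g -` ball (g x) (\<epsilon>/2)" "z \<in> g -` ball (g x) (\<epsilon>/2)" for y z
    using that dist_triangle_half_r[of "g x" "g y" \<epsilon> "g z"] by simp
  ultimately show "\<exists>U. open U \<and> x \<in> U \<and> (\<forall>y\<in>U. \<forall>z\<in>U. dist (g y) (g z) < \<epsilon>)"
    using assms(2) by (intro exI[of _ "g -` ball (g x) (\<epsilon>/2)"]) auto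
qed (use that in blast)

lemma clopen_locality:
  fixes E :: "(int \<Rightarrow> 'a::{finite,discrete_topology}) set"
  assumes "open E" "closed E"
  obtains L :: nat where "\<And>x y. (\<And>i. \<bar>i\<bar> \<le> int L \<Longrightarrow> x i = y i) \<Longrightarrow> x \<in> E \<longleftrightarrow> y \<in> E"
proof (rule uniform_locality[of "\<lambda>y z. y \<in> E \<longleftrightarrow> z \<in> E"])
  fix x
  show "\<exists>U. open U \<and> x \<in> U \<and> (\<forall>y\<in>U. \<forall>z\<in>U. (y \<in> E) = (z \<in> E))"
    using assms by (intro exI[of _ "if x \<in> E then E else - E"]) auto
qed (use that in blast)

lemma block_centered:
  assumes "block x (- int L) (2 * L + 1) = block y (- int L) (2 * L + 1)" "\<bar>i\<bar> \<le> int L"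
  shows "x i = y i"
proof -
  have "- int L + int (nat (i + int L)) = i" "nat (i + int L) < 2 * L + 1" using assms(2) by auto
  with assms(1) show ?thesis unfolding block_eq_iff by metis
qed

lemma clopen_block: "open {x :: int \<Rightarrow> 'a::{finite,discrete_topology}. block x a n = k}"
    "closed {x :: int \<Rightarrow> 'a::{finite,discrete_topology}. block x a n = k}"
proof -
  \<comment> \<open>An arbitrary set \<open>S\<close> of codes is allowed, so that the complement of
    a block event is covered as well.\<close>
  have *: "open {x :: int \<Rightarrow> 'a. block x a n \<in> S}" for S
  proof (subst open_subopen, safe)
    fix x :: "int \<Rightarrow> 'a" assume S: "block x a n \<in> S"
    have eq: "block y a n = block x a n" if "\<forall>i\<in>{a..<a + int n}. y i = x i" for y
      using that by (intro block_eqI) auto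
    have "{y. \<forall>i\<in>{a..<a + int n}. y i = x i} \<subseteq> {x. block x a n \<in> S}"
    proof
      fix y assume "y \<in> {y. \<forall>i\<in>{a..<a + int n}. y i = x i}"
      then have "block y a n = block x a n" by (intro eq) simp
      with S show "y \<in> {x. block x a n \<in> S}" by simp
    qed
    moreover have "open {y. \<forall>i\<in>{a..<a + int n}. y i = x i}" by (rule open_agree) simp
    ultimately show "\<exists>T. open T \<and> x \<in> T \<and> T \<subseteq> {x. block x a n \<in> S}" by blast
  qed
  show "open {x :: int \<Rightarrow> 'a. block x a n = k}" using *[of "{k}"] by simp
  have "- {x :: int \<Rightarrow> 'a. block x a n = k} = {x. block x a n \<in> -{k}}" by auto
  then show "closed {x :: int \<Rightarrow> 'a. block x a n = k}" using *[of "-{k}"] by (simp add: closed_def)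
qed

lemma continuous_shift: "continuous_on UNIV (shift :: (int \<Rightarrow> 'a::topological_space) \<Rightarrow> _)"
  unfolding shift_def by (intro continuous_on_coordinatewise_then_product continuous_on_product_coordinates)

section \<open>Invariant measures as a metric space\<close>

lemma invariant_measuresD:
  assumes "\<mu> \<in> invariant_measures"
  shows "prob_space \<mu>" "sets \<mu> = sets borel" "space \<mu> = UNIV" "distr \<mu> borel shift = \<mu>"
  using assms sets_eq_imp_space_eq[of \<mu> borel] by (auto simp: invariant_measures_def)

lemma shift_measurable:
  assumes "sets \<mu> = sets borel"
  shows "(shift :: (int \<Rightarrow> 'a::{finite,discrete_topology}) \<Rightarrow> _) \<in> measurable \<mu> borel"
proof -
  have "(shift :: (int \<Rightarrow> 'a) \<Rightarrow> _) \<in> measurable borel borel"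
    by (rule borel_measurable_continuous_onI[OF continuous_shift])
  then show ?thesis using measurable_cong_sets[OF assms refl] by blast
qed

lemma measure_vimage_shift:
  assumes "\<mu> \<in> invariant_measures" "E \<in> sets borel"
  shows "measure \<mu> (shift -` E) = measure \<mu> E"
proof -
  note inv = invariant_measuresD[OF assms(1)]
  have "measure (distr \<mu> borel shift) E = measure \<mu> (shift -` E \<inter> space \<mu>)"
    using assms(2) shift_measurable[OF inv(2)] by (rule measure_distr[rotated])
  then show ?thesis by (simp add: inv)
qed

lemma block_sets [measurable]:
  "{x :: int \<Rightarrow> 'a::{finite,discrete_topology}. block x a n = k} \<in> sets borel"
  by (rule borel_closed[OF clopen_block(2)])

lemma block_set_sets: "block_set n k \<in> sets (borel :: (int \<Rightarrow> 'a::{finite,discrete_topology}) measure)"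
  by (simp add: block_set_def block_sets)

text \<open>Invariance moves a block by one cell, and induction in both directions reaches every
  integer. Central windows and displaced image blocks are thereby reduced to blocks at 0.\<close>

lemma measure_block:
  assumes "\<mu> \<in> invariant_measures"
  shows "measure \<mu> {x. block x a n = k} = measure \<mu> (block_set n k)"
proof -
  have *: "measure \<mu> {x. block x (a + 1) n = k} = measure \<mu> {x. block x a n = k}" for a
    using measure_vimage_shift[OF assms block_sets, of a n k] by (simp add: block_shift vimage_def)
  show ?thesis unfolding block_set_def
  proof (induction a rule: int_induct[where k = 0])
    case (step2 i)
    then show ?case using *[of "i - 1"] by simp
  qed (use * in auto)
qed

lemma measure_block_in:
  fixes \<mu> :: "(int \<Rightarrow> 'a::{finite,discrete_topology}) measure"
  assumes "\<mu> \<in> invariant_measures" "finite S"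
  shows "measure \<mu> {x. block x a n \<in> S} = (\<Sum>k\<in>S. measure \<mu> (block_set n k))"
proof -
  interpret prob_space \<mu> by (rule invariant_measuresD[OF assms(1)])
  have "measure \<mu> (\<Union>k\<in>S. {x. block x a n = k}) = (\<Sum>k\<in>S. measure \<mu> {x. block x a n = k})"
    by (rule finite_measure_finite_Union)
      (auto simp: assms invariant_measuresD disjoint_family_on_def block_sets)
  moreover have "(\<Union>k\<in>S. {x :: int \<Rightarrow> 'a. block x a n = k}) = {x. block x a n \<in> S}" by auto
  ultimately show ?thesis by (simp add: measure_block[OF assms(1)])
qed

section \<open>Clopen sets as a generating algebra\<close>

definition clopens :: "'b::topological_space set set" where
  "clopens = {E. open E \<and> closed E}"

lemma clopens_algebra: "algebra UNIV (clopens :: 'b::topological_space set set)"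
  by (auto simp: algebra_iff_Un clopens_def)

text \<open>By compactness, membership in a clopen set depends on one finite window, and that window
  admits only finitely many codes.\<close>

lemma clopen_eq_block_in:
  fixes E :: "(int \<Rightarrow> 'a::{finite,discrete_topology}) set"
  assumes "E \<in> clopens"
  obtains a n S where "finite S" "E = {x. block x a n \<in> S}"
proof -
  obtain L :: nat where L: "\<And>x y. (\<And>i. \<bar>i\<bar> \<le> int L \<Longrightarrow> x i = y i) \<Longrightarrow> x \<in> E \<longleftrightarrow> y \<in> E"
    using clopen_locality[of E] assms by (auto simp: clopens_def)
  define b where "b = (\<lambda>x :: int \<Rightarrow> 'a. block x (- int L) (2 * L + 1))"
  have "b ` E \<subseteq> {..<CARD('a) ^ (2 * L + 1)}" unfolding b_def using block_less by blast
  then have "finite (b ` E)" using finite_subset by blast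
  moreover have "x \<in> E" if bx: "b x \<in> b ` E" for x
  proof -
    obtain y where y: "y \<in> E" "b x = b y" using bx by auto
    have "x i = y i" if "\<bar>i\<bar> \<le> int L" for i
      using block_centered[OF y(2)[unfolded b_def] that] .
    then show ?thesis using L y(1) by blast
  qed
  then have "E = {x. b x \<in> b ` E}" by blast
  ultimately show ?thesis using that unfolding b_def by blast
qed

lemma sets_borel_clopens:
  "sets (borel :: (int \<Rightarrow> 'a::{finite,discrete_topology}) measure) = sigma_sets UNIV clopens"
proof
  interpret S: sigma_algebra UNIV "sigma_sets UNIV (clopens :: (int \<Rightarrow> 'a) set set)"
    by (rule sigma_algebra_sigma_sets) auto
  have "U \<in> sigma_sets UNIV clopens" if U: "open U" for U :: "(int \<Rightarrow> 'a) set"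
  proof -
    \<comment> \<open>The central block events form a basis indexed by pairs of natural numbers.
      Countability is the point: the union that represents \<open>U\<close> stays in the
      sigma-algebra.\<close>
    define B where "B p = {x :: int \<Rightarrow> 'a. block x (- int (fst p)) (2 * fst p + 1) = snd p}" for p
    have B: "B p \<in> clopens" for p
      by (simp add: B_def clopens_def clopen_block)
    have "U \<subseteq> \<Union> (B ` {p. B p \<subseteq> U})"
    proof
      fix x assume "x \<in> U"
      obtain L :: nat where L: "{y. \<forall>i\<in>{-int L..int L}. y i = x i} \<subseteq> U"
        using open_contains_agree[OF U \<open>x \<in> U\<close>] .
      define p where "p = (L, block x (- int L) (2 * L + 1))"
      have "B p \<subseteq> U"
      proof
        fix y assume "y \<in> B p"
        then have "y i = x i" if "i \<in> {-int L..int L}" for i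
          using that block_centered[of y L x i] by (auto simp: B_def p_def)
        then show "y \<in> U" using L by blast
      qed
      moreover have "x \<in> B p" by (simp add: B_def p_def)
      ultimately show "x \<in> \<Union> (B ` {p. B p \<subseteq> U})" by blast
    qed
    then have "U = \<Union> (B ` {p. B p \<subseteq> U})" by blast
    moreover have "\<Union> (B ` {p. B p \<subseteq> U}) \<in> sigma_sets UNIV clopens"
      by (rule S.countable_UN') (use B in auto)
    ultimately show ?thesis by simp
  qed
  then have "sigma_sets UNIV {U :: (int \<Rightarrow> 'a) set. open U} \<subseteq> sigma_sets UNIV clopens"
    by (intro sigma_sets_mono) blast
  then show "sets (borel :: (int \<Rightarrow> 'a) measure) \<subseteq> sigma_sets UNIV clopens"
    unfolding borel_def by simp
  show "sigma_sets UNIV clopens \<subseteq> sets (borel :: (int \<Rightarrow> 'a) measure)"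
  proof -
    have "clopens \<subseteq> sets (borel :: (int \<Rightarrow> 'a) measure)" by (auto simp: clopens_def)
    from sets.sigma_sets_subset[OF this] show ?thesis by simp
  qed
qed

lemma measure_eqI_clopens:
  fixes \<mu> \<nu> :: "(int \<Rightarrow> 'a::{finite,discrete_topology}) measure"
  assumes "sets \<mu> = sets borel" "sets \<nu> = sets borel" "finite_measure \<mu>" "finite_measure \<nu>"
    and "\<And>E. E \<in> clopens \<Longrightarrow> measure \<mu> E = measure \<nu> E"
  shows "\<mu> = \<nu>"
proof (rule measure_eqI_generator_eq[where E = clopens and \<Omega> = UNIV and A = "\<lambda>_. UNIV"])
  show "Int_stable (clopens :: (int \<Rightarrow> 'a) set set)" by (auto simp: Int_stable_def clopens_def)
  show "emeasure \<mu> E = emeasure \<nu> E" if "E \<in> clopens" for E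
    using assms that by (simp add: finite_measure.emeasure_eq_measure)
  show "emeasure \<mu> UNIV \<noteq> \<infinity>"
    using assms(3) by (simp add: finite_measure.emeasure_eq_measure)
qed (auto simp: assms sets_borel_clopens clopens_def)

lemma measure_eqI_blocks:
  fixes \<mu> \<nu> :: "(int \<Rightarrow> 'a::{finite,discrete_topology}) measure"
  assumes "\<mu> \<in> invariant_measures" "\<nu> \<in> invariant_measures"
    and "\<And>n k. measure \<mu> (block_set n k) = measure \<nu> (block_set n k)"
  shows "\<mu> = \<nu>"
proof (rule measure_eqI_clopens)
  fix E :: "(int \<Rightarrow> 'a) set" assume "E \<in> clopens"
  then obtain a n S where "finite S" "E = {x. block x a n \<in> S}" by (rule clopen_eq_block_in)
  then show "measure \<mu> E = measure \<nu> E" using assms by (simp add: measure_block_in)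
qed (use assms in \<open>simp_all add: invariant_measuresD(1,2) prob_space.axioms(1)\<close>)

section \<open>The distance in terms of block codes\<close>

definition block_dist :: "nat \<Rightarrow> (int \<Rightarrow> 'a::{finite,discrete_topology}) measure \<Rightarrow> (int \<Rightarrow> 'a) measure \<Rightarrow> real" where
  "block_dist n \<mu> \<nu> =
     (MAX k\<in>{..<CARD('a) ^ n}. \<bar>measure \<mu> (block_set n k) - measure \<nu> (block_set n k)\<bar>)"

lemma measure_dist_block_dist: "measure_dist \<mu> \<nu> = (\<Sum>n. (1/2) ^ n * block_dist n \<mu> \<nu>)"
  for \<mu> :: "(int \<Rightarrow> 'a::{finite,discrete_topology}) measure"
  unfolding measure_dist_def block_dist_def words_eq_nat_words image_image
  by (intro suminf_cong arg_cong2[where f = "(*)"] refl arg_cong[where f = Max] image_cong)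
    (simp add: cylinder_nat_word)

lemma block_set_dist_le:
  fixes \<mu> :: "(int \<Rightarrow> 'a::{finite,discrete_topology}) measure"
  shows "\<bar>measure \<mu> (block_set n k) - measure \<nu> (block_set n k)\<bar> \<le> block_dist n \<mu> \<nu>"
proof (cases "k < CARD('a) ^ n")
  case True
  then show ?thesis unfolding block_dist_def by (intro Max_ge) auto
next
  case False
  then have "block_set n k = ({} :: (int \<Rightarrow> 'a) set)"
    using block_less[where 'a='a] by (auto simp: block_set_def)
  moreover have "0 \<le> \<bar>measure \<mu> (block_set n 0) - measure \<nu> (block_set n 0)\<bar>" by simp
  also have "\<dots> \<le> block_dist n \<mu> \<nu>"
    unfolding block_dist_def using card_power_pos[where 'a='a] by (intro Max_ge) auto
  ultimately show ?thesis by simp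
qed

lemma block_dist_nonneg: "0 \<le> block_dist n \<mu> \<nu>"
  using block_set_dist_le[of \<mu> n 0 \<nu>] by linarith

lemma block_dist_leI:
  fixes \<mu> :: "(int \<Rightarrow> 'a::{finite,discrete_topology}) measure"
  assumes "\<And>k. k < CARD('a) ^ n \<Longrightarrow> \<bar>measure \<mu> (block_set n k) - measure \<nu> (block_set n k)\<bar> \<le> b"
  shows "block_dist n \<mu> \<nu> \<le> b"
proof -
  have "{..<CARD('a) ^ n} \<noteq> {}" using card_power_pos[where 'a='a, of n] by blast
  then show ?thesis unfolding block_dist_def using assms by (subst Max_le_iff) auto
qed

lemma block_dist_commute: "block_dist n \<mu> \<nu> = block_dist n \<nu> \<mu>"
  by (simp add: block_dist_def abs_minus_commute)

lemma block_dist_triangle: "block_dist n \<mu> \<rho> \<le> block_dist n \<mu> \<nu> + block_dist n \<nu> \<rho>"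
proof (rule block_dist_leI)
  fix k
  show "\<bar>measure \<mu> (block_set n k) - measure \<rho> (block_set n k)\<bar> \<le> block_dist n \<mu> \<nu> + block_dist n \<nu> \<rho>"
    using block_set_dist_le[of \<mu> n k \<nu>] block_set_dist_le[of \<nu> n k \<rho>] by linarith
qed

lemma block_dist_le_1:
  assumes "prob_space \<mu>" "prob_space \<nu>"
  shows "block_dist n \<mu> \<nu> \<le> 1"
proof (rule block_dist_leI)
  fix k
  have "measure \<mu> (block_set n k) \<le> 1" "measure \<nu> (block_set n k) \<le> 1"
    using assms by (auto intro: prob_space.prob_le_1)
  then show "\<bar>measure \<mu> (block_set n k) - measure \<nu> (block_set n k)\<bar> \<le> 1"
    using measure_nonneg[of \<mu> "block_set n k"] measure_nonneg[of \<nu> "block_set n k"] by linarith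
qed

lemma summable_block_dist:
  assumes "prob_space \<mu>" "prob_space \<nu>"
  shows "summable (\<lambda>n. (1/2) ^ n * block_dist n \<mu> \<nu>)"
proof (rule summable_comparison_test'[of "\<lambda>n. (1/2) ^ n" 0])
  fix n
  show "norm ((1/2) ^ n * block_dist n \<mu> \<nu>) \<le> (1/2) ^ n"
    using block_dist_le_1[OF assms, of n] block_dist_nonneg[of n \<mu> \<nu>] by (simp add: abs_mult mult_left_le)
qed simp

text \<open>Every \<open>block_dist\<close> lies between 0 and 1, so the terms from \<open>N\<close>
  on contribute at most the geometric tail \<open>2 * (1/2) ^ N\<close>.\<close>

lemma measure_dist_truncate:
  assumes "prob_space \<mu>" "prob_space \<nu>"
  shows "(\<Sum>n<N. (1/2) ^ n * block_dist n \<mu> \<nu>) \<le> measure_dist \<mu> \<nu>"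
    and "measure_dist \<mu> \<nu> \<le> (\<Sum>n<N. (1/2) ^ n * block_dist n \<mu> \<nu>) + 2 * (1/2) ^ N"
proof -
  let ?f = "\<lambda>n. (1/2) ^ n * block_dist n \<mu> \<nu>"
  note s = summable_block_dist[OF assms]
  have split: "measure_dist \<mu> \<nu> = (\<Sum>n. ?f (n + N)) + (\<Sum>n<N. ?f n)"
    unfolding measure_dist_block_dist by (rule suminf_split_initial_segment[OF s])
  have s': "summable (\<lambda>n. ?f (n + N))" using s by (rule summable_ignore_initial_segment)
  have "0 \<le> (\<Sum>n. ?f (n + N))" by (intro suminf_nonneg s') (simp add: block_dist_nonneg)
  with split show "(\<Sum>n<N. ?f n) \<le> measure_dist \<mu> \<nu>" by simp
  have "(\<Sum>n. ?f (n + N)) \<le> (\<Sum>n. (1/2) ^ N * (1/2) ^ n)"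
    using block_dist_le_1[OF assms]
    by (intro suminf_le s') (auto simp: power_add mult_left_le intro!: summable_mult summable_geometric)
  also have "\<dots> = 2 * (1/2) ^ N"
    by (subst suminf_mult) (auto simp: suminf_geometric intro: summable_geometric)
  finally show "measure_dist \<mu> \<nu> \<le> (\<Sum>n<N. ?f n) + 2 * (1/2) ^ N" using split by simp
qed

text \<open>The weights sum to less than 2, which accounts for the factor of \<open>b\<close>; the
  other summand is the truncation error. Closeness on finitely many blocks thus controls the
  metric.\<close>

lemma measure_dist_leI:
  fixes \<mu> :: "(int \<Rightarrow> 'a::{finite,discrete_topology}) measure"
  assumes "prob_space \<mu>" "prob_space \<nu>"
    and "\<And>n k. n < N \<Longrightarrow> k < CARD('a) ^ n \<Longrightarrow> \<bar>measure \<mu> (block_set n k) - measure \<nu> (block_set n k)\<bar> \<le> b"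
    and "0 \<le> b"
  shows "measure_dist \<mu> \<nu> \<le> 2 * b + 2 * (1/2) ^ N"
proof -
  have "(\<Sum>n<N. (1/2) ^ n * block_dist n \<mu> \<nu>) \<le> (\<Sum>n<N. (1/2) ^ n * b)"
    using assms(3) by (intro sum_mono mult_left_mono block_dist_leI) auto
  also have "\<dots> = (2 - 2 * (1/2) ^ N) * b"
  proof -
    have "(\<Sum>n<N. (1/2) ^ n) = 2 - 2 * (1/2 :: real) ^ N" by (induction N) auto
    then show ?thesis by (simp only: sum_distrib_right[symmetric])
  qed
  also have "\<dots> \<le> 2 * b" using assms(4) by (simp add: algebra_simps)
  finally show ?thesis using measure_dist_truncate(2)[OF assms(1,2), of N] by linarith
qed

lemma block_set_dist_le_measure_dist:
  assumes "prob_space \<mu>" "prob_space \<nu>"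
  shows "\<bar>measure \<mu> (block_set n k) - measure \<nu> (block_set n k)\<bar> \<le> 2 ^ n * measure_dist \<mu> \<nu>"
proof -
  have "(1/2) ^ n * block_dist n \<mu> \<nu> \<le> (\<Sum>n<Suc n. (1/2) ^ n * block_dist n \<mu> \<nu>)"
    by (rule member_le_sum) (auto simp: block_dist_nonneg)
  also have "\<dots> \<le> measure_dist \<mu> \<nu>" by (rule measure_dist_truncate[OF assms])
  finally have "block_dist n \<mu> \<nu> \<le> 2 ^ n * measure_dist \<mu> \<nu>" by (simp add: field_simps power_divide)
  then show ?thesis using block_set_dist_le[of \<mu> n k \<nu>] by linarith
qed

lemma measure_dist_nonneg: "prob_space \<mu> \<Longrightarrow> prob_space \<nu> \<Longrightarrow> 0 \<le> measure_dist \<mu> \<nu>"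
  using measure_dist_truncate(1)[of \<mu> \<nu> 0] by simp

lemma measure_dist_triangle:
  assumes "prob_space \<mu>" "prob_space \<nu>" "prob_space \<rho>"
  shows "measure_dist \<mu> \<rho> \<le> measure_dist \<mu> \<nu> + measure_dist \<nu> \<rho>"
proof -
  note s = summable_block_dist[OF assms(1,2)] summable_block_dist[OF assms(2,3)]
  have "measure_dist \<mu> \<rho> \<le> (\<Sum>n. (1/2) ^ n * block_dist n \<mu> \<nu> + (1/2) ^ n * block_dist n \<nu> \<rho>)"
    unfolding measure_dist_block_dist
    by (intro suminf_le summable_block_dist summable_add s assms)
      (auto simp flip: distrib_left intro: block_dist_triangle)
  then show ?thesis unfolding measure_dist_block_dist by (simp add: suminf_add[OF s])
qed

lemma measure_dist_commute: "measure_dist \<mu> \<nu> = measure_dist \<nu> \<mu>"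
  by (simp add: measure_dist_block_dist block_dist_commute)

text \<open>The absolute value only matters for measures that are not probability measures: for them
  the series may diverge, and then nothing is known about the sign of its sum.\<close>

interpretation invariant_measures: Metric_space
  "invariant_measures :: (int \<Rightarrow> 'a::{finite,discrete_topology}) measure set" "\<lambda>\<mu> \<nu>. \<bar>measure_dist \<mu> \<nu>\<bar>"
proof
  fix \<mu> \<nu> :: "(int \<Rightarrow> 'a) measure"
  show "\<bar>measure_dist \<mu> \<nu>\<bar> = \<bar>measure_dist \<nu> \<mu>\<bar>" by (simp add: measure_dist_commute)
  assume inv: "\<mu> \<in> invariant_measures" "\<nu> \<in> invariant_measures"
  note prob = this[THEN invariant_measuresD(1)]
  show "\<bar>measure_dist \<mu> \<nu>\<bar> = 0 \<longleftrightarrow> \<mu> = \<nu>"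
  proof
    assume "\<bar>measure_dist \<mu> \<nu>\<bar> = 0"
    then have "measure \<mu> (block_set n k) = measure \<nu> (block_set n k)" for n k
      using block_set_dist_le_measure_dist[OF prob, of n k] by simp
    then show "\<mu> = \<nu>" using inv by (intro measure_eqI_blocks)
  next
    assume "\<mu> = \<nu>"
    moreover have "block_dist n \<mu> \<mu> = 0" for n
      using block_dist_nonneg[of n \<mu> \<mu>] block_dist_leI[of n \<mu> \<mu> 0] by simp
    ultimately show "\<bar>measure_dist \<mu> \<nu>\<bar> = 0" by (simp add: measure_dist_block_dist)
  qed
  fix \<rho> :: "(int \<Rightarrow> 'a) measure" assume "\<rho> \<in> invariant_measures"
  then show "\<bar>measure_dist \<mu> \<rho>\<bar> \<le> \<bar>measure_dist \<mu> \<nu>\<bar> + \<bar>measure_dist \<nu> \<rho>\<bar>"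
    using measure_dist_triangle[of \<mu> \<nu> \<rho>] measure_dist_nonneg[of \<mu> \<rho>] prob invariant_measuresD(1)
    by fastforce
qed simp

section \<open>The weak topology\<close>

lemma continuous_integrable:
  fixes g :: "(int \<Rightarrow> 'a::{finite,discrete_topology}) \<Rightarrow> real"
  assumes "continuous_on UNIV g" "\<mu> \<in> invariant_measures"
  shows "integrable \<mu> g"
proof -
  interpret prob_space \<mu> by (rule invariant_measuresD[OF assms(2)])
  have "compact (g ` UNIV)"
    using compact_continuous_image[OF assms(1) compact_configs] .
  then obtain B where "\<forall>x. \<bar>g x\<bar> \<le> B"
    by (auto simp: bounded_iff dest!: compact_imp_bounded)
  moreover have "g \<in> borel_measurable \<mu>"
    using borel_measurable_continuous_onI[OF assms(1)]
    by (simp add: measurable_cong_sets[OF invariant_measuresD(2)[OF assms(2)] refl])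
  ultimately show ?thesis by (intro integrable_const_bound[where B = B]) auto
qed

text \<open>By compactness \<open>g\<close> is uniformly close to a function of a central block; invariance makes the
  position of the block irrelevant.\<close>

lemma integral_block_approx:
  fixes g :: "(int \<Rightarrow> 'a::{finite,discrete_topology}) \<Rightarrow> real"
  assumes "continuous_on UNIV g" "0 < \<epsilon>"
  obtains n c where "\<And>\<mu>. \<mu> \<in> invariant_measures \<Longrightarrow>
    \<bar>(\<integral>x. g x \<partial>\<mu>) - (\<Sum>k<CARD('a) ^ n. c k * measure \<mu> (block_set n k))\<bar> \<le> \<epsilon>"
proof -
  obtain L :: nat where L: "\<And>x y. (\<And>i. \<bar>i\<bar> \<le> int L \<Longrightarrow> x i = y i) \<Longrightarrow> dist (g x) (g y) < \<epsilon>"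
    using continuous_uniform_locality[OF assms] by blast
  define n where "n = 2 * L + 1"
  define b where "b x = block x (- int L) n" for x :: "int \<Rightarrow> 'a"
  define c where "c k = g (SOME x. b x = k)" for k
  define h where "h x = (\<Sum>k<CARD('a) ^ n. c k * indicator {x. b x = k} x)" for x
  have gh: "\<bar>g x - h x\<bar> \<le> \<epsilon>" for x
  proof -
    define y where "y = (SOME y. b y = b x)"
    have "b y = b x" unfolding y_def by (rule someI[of _ x]) simp
    then have "dist (g x) (g y) < \<epsilon>"
      using block_centered[of x L y] by (intro L) (simp add: b_def n_def)
    moreover have "h x = (\<Sum>k<CARD('a) ^ n. if k = b x then c k else 0)"
      unfolding h_def by (intro sum.cong) (auto simp: indicator_def)
    then have "h x = c (b x)" using block_less[of x "- int L" n] by (simp add: b_def)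
    ultimately show ?thesis by (simp add: c_def y_def dist_real_def)
  qed
  show ?thesis
  proof (rule that[of c n])
    fix \<mu> :: "(int \<Rightarrow> 'a) measure" assume inv: "\<mu> \<in> invariant_measures"
    interpret prob_space \<mu> by (rule invariant_measuresD[OF inv])
    have meas: "{x. b x = k} \<in> sets \<mu>" for k
      by (simp add: b_def invariant_measuresD[OF inv] block_sets)
    then have int: "integrable \<mu> (\<lambda>x. c k * indicator {x. b x = k} x)" for k
      by (intro integrable_mult_right integrable_real_indicator) (auto simp: emeasure_eq_measure)
    have "(\<integral>x. h x \<partial>\<mu>) = (\<Sum>k<CARD('a) ^ n. c k * measure \<mu> {x. b x = k})"
      unfolding h_def using meas
      by (subst Bochner_Integration.integral_sum[OF int]) (simp add: invariant_measuresD[OF inv])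
    moreover have "measure \<mu> {x. b x = k} = measure \<mu> (block_set n k)" for k
      unfolding b_def by (rule measure_block[OF inv])
    moreover have "\<bar>(\<integral>x. g x \<partial>\<mu>) - (\<integral>x. h x \<partial>\<mu>)\<bar> \<le> \<epsilon>"
    proof -
      have ih: "integrable \<mu> h" unfolding h_def by (intro Bochner_Integration.integrable_sum int)
      note ig = continuous_integrable[OF assms(1) inv]
      have "(\<integral>x. g x \<partial>\<mu>) - (\<integral>x. h x \<partial>\<mu>) = (\<integral>x. g x - h x \<partial>\<mu>)" using ih ig by simp
      also have "\<bar>\<dots>\<bar> \<le> (\<integral>x. \<bar>g x - h x\<bar> \<partial>\<mu>)" by (rule integral_abs_bound)
      also have "\<dots> \<le> (\<integral>x. \<epsilon> \<partial>\<mu>)"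
        using ih ig gh by (intro integral_mono) auto
      finally show ?thesis by (simp add: prob_space)
    qed
    ultimately show "\<bar>(\<integral>x. g x \<partial>\<mu>) - (\<Sum>k<CARD('a) ^ n. c k * measure \<mu> (block_set n k))\<bar> \<le> \<epsilon>"
      by simp
  qed
qed

lemma integral_measure_dist_continuous:
  fixes g :: "(int \<Rightarrow> 'a::{finite,discrete_topology}) \<Rightarrow> real"
  assumes "continuous_on UNIV g" "0 < \<epsilon>"
  obtains \<delta> where "0 < \<delta>" "\<And>\<mu> \<nu>. \<mu> \<in> invariant_measures \<Longrightarrow> \<nu> \<in> invariant_measures \<Longrightarrow>
    measure_dist \<mu> \<nu> < \<delta> \<Longrightarrow> \<bar>(\<integral>x. g x \<partial>\<mu>) - (\<integral>x. g x \<partial>\<nu>)\<bar> < \<epsilon>"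
proof -
  have "0 < \<epsilon> / 3" using assms(2) by simp
  then obtain n c where c: "\<And>\<mu>. \<mu> \<in> invariant_measures \<Longrightarrow>
    \<bar>(\<integral>x. g x \<partial>\<mu>) - (\<Sum>k<CARD('a) ^ n. c k * measure \<mu> (block_set n k))\<bar> \<le> \<epsilon> / 3"
    using integral_block_approx[OF assms(1)] by blast
  \<comment> \<open>\<open>K\<close> serves as a Lipschitz constant of the finite sum with respect
    to \<open>measure_dist\<close>; the added 1 keeps it positive when all \<open>c k\<close>
    vanish.\<close>
  define K where "K = (\<Sum>k<CARD('a) ^ n. \<bar>c k\<bar> * 2 ^ n) + 1"
  have K: "K > 0" unfolding K_def by (intro add_nonneg_pos sum_nonneg) auto
  show ?thesis
  proof (rule that[of "\<epsilon> / 3 / K"])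
    show "0 < \<epsilon> / 3 / K" using assms(2) K by simp
    fix \<mu> \<nu> :: "(int \<Rightarrow> 'a) measure"
    assume inv: "\<mu> \<in> invariant_measures" "\<nu> \<in> invariant_measures" and d: "measure_dist \<mu> \<nu> < \<epsilon> / 3 / K"
    note prob = inv[THEN invariant_measuresD(1)]
    have "\<bar>(\<Sum>k<CARD('a) ^ n. c k * measure \<mu> (block_set n k)) - (\<Sum>k<CARD('a) ^ n. c k * measure \<nu> (block_set n k))\<bar>
        \<le> (\<Sum>k<CARD('a) ^ n. \<bar>c k * (measure \<mu> (block_set n k) - measure \<nu> (block_set n k))\<bar>)"
      unfolding sum_subtractf[symmetric] right_diff_distrib[symmetric] by (rule sum_abs)
    also have "\<dots> \<le> (\<Sum>k<CARD('a) ^ n. \<bar>c k\<bar> * (2 ^ n * measure_dist \<mu> \<nu>))"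
      unfolding abs_mult by (intro sum_mono mult_left_mono block_set_dist_le_measure_dist prob) auto
    also have "\<dots> = (K - 1) * measure_dist \<mu> \<nu>"
      by (simp add: K_def sum_distrib_right mult.assoc)
    also have "\<dots> \<le> K * measure_dist \<mu> \<nu>"
      using measure_dist_nonneg[OF prob] by (intro mult_right_mono) auto
    also have "\<dots> < \<epsilon> / 3" using d K by (simp add: field_simps)
    finally show "\<bar>(\<integral>x. g x \<partial>\<mu>) - (\<integral>x. g x \<partial>\<nu>)\<bar> < \<epsilon>"
      using c[OF inv(1)] c[OF inv(2)] by linarith
  qed
qed

lemma openin_weak_star_integral:
  "continuous_on UNIV g \<Longrightarrow> open U \<Longrightarrow> openin weak_star {\<mu> \<in> invariant_measures. (\<integral>x. g x \<partial>\<mu>) \<in> U}"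
  for g :: "(int \<Rightarrow> 'a::{finite,discrete_topology}) \<Rightarrow> real"
  unfolding weak_star_def by (rule topology_generated_by_Basis) blast

lemma continuous_indicator_clopen:
  "E \<in> clopens \<Longrightarrow> continuous_on UNIV (indicator E :: 'b::topological_space \<Rightarrow> real)"
proof -
  assume E: "E \<in> clopens"
  have "(indicator E -` B :: 'b set) = (if 1 \<in> B then E else {}) \<union> (if 0 \<in> B then - E else {})"
    for B :: "real set" by (auto simp: indicator_def of_bool_def split: if_splits)
  then show ?thesis using E by (simp add: continuous_on_open_vimage clopens_def open_Compl)
qed

lemma openin_weak_star_block_set:
  assumes "open U"
  shows "openin weak_star {\<mu> \<in> invariant_measures.
    measure \<mu> (block_set n k :: (int \<Rightarrow> 'a::{finite,discrete_topology}) set) \<in> U}"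
proof -
  have "block_set n k \<in> (clopens :: (int \<Rightarrow> 'a) set set)"
    by (simp add: clopens_def block_set_def clopen_block)
  from openin_weak_star_integral[OF continuous_indicator_clopen[OF this] assms]
  show ?thesis
    by (rule back_subst[where P = "openin weak_star"])
      (auto simp: invariant_measuresD block_set_sets)
qed

text \<open>Integrals of continuous functions are continuous for the metric, so the subbasic weak
  sets are metrically open. Conversely, finitely many conditions on block probabilities fit inside a
  ball, and these are weakly open because indicators of clopen sets are continuous.\<close>

lemma weak_star_eq_mtopology:
  "weak_star = (invariant_measures.mtopology :: (int \<Rightarrow> 'a::{finite,discrete_topology}) measure topology)"
  (is "_ = ?M")
proof (rule topology_eq[THEN iffD2], intro allI iffI)
  fix S :: "(int \<Rightarrow> 'a) measure set"
  assume "openin weak_star S"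
  then have gen: "generate_topology_on {{\<mu> \<in> invariant_measures. (\<integral>x. g x \<partial>\<mu>) \<in> U} | (g :: (int \<Rightarrow> 'a) \<Rightarrow> real) U.
        continuous_on UNIV g \<and> open U} S"
    unfolding weak_star_def openin_topology_generated_by_iff .
  show "openin ?M S"
  proof (rule generate_topology_on_coarsest[OF _ _ gen])
    fix T assume "T \<in> {{\<mu> \<in> invariant_measures. (\<integral>x. g x \<partial>\<mu>) \<in> U} | (g :: (int \<Rightarrow> 'a) \<Rightarrow> real) U.
        continuous_on UNIV g \<and> open U}"
    then obtain g :: "(int \<Rightarrow> 'a) \<Rightarrow> real" and U
      where T: "T = {\<mu> \<in> invariant_measures. (\<integral>x. g x \<partial>\<mu>) \<in> U}" and g: "continuous_on UNIV g" and U: "open U"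
      by auto
    show "openin ?M T" unfolding invariant_measures.openin_mtopology
    proof safe
      fix \<mu> assume \<mu>: "\<mu> \<in> T"
      then obtain \<epsilon> where \<epsilon>: "\<epsilon> > 0" "ball (\<integral>x. g x \<partial>\<mu>) \<epsilon> \<subseteq> U"
        using U open_contains_ball T by blast
      obtain \<delta> where \<delta>: "\<delta> > 0" "\<And>\<mu> \<nu>. \<mu> \<in> invariant_measures \<Longrightarrow> \<nu> \<in> invariant_measures \<Longrightarrow>
          measure_dist \<mu> \<nu> < \<delta> \<Longrightarrow> \<bar>(\<integral>x. g x \<partial>\<mu>) - (\<integral>x. g x \<partial>\<nu>)\<bar> < \<epsilon>"
        using integral_measure_dist_continuous[OF g \<epsilon>(1)] by blast
      have "invariant_measures.mball \<mu> \<delta> \<subseteq> T"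
      proof
        fix \<nu> assume "\<nu> \<in> invariant_measures.mball \<mu> \<delta>"
        then have "\<nu> \<in> invariant_measures" "\<bar>(\<integral>x. g x \<partial>\<mu>) - (\<integral>x. g x \<partial>\<nu>)\<bar> < \<epsilon>"
          using \<delta>(2)[of \<mu> \<nu>] by (auto simp: invariant_measures.in_mball)
        then show "\<nu> \<in> T" using \<epsilon>(2) by (auto simp: T dist_real_def)
      qed
      then show "\<exists>r>0. invariant_measures.mball \<mu> r \<subseteq> T" using \<delta>(1) by blast
    qed (simp add: T)
  qed simp
next
  fix S :: "(int \<Rightarrow> 'a) measure set"
  assume S: "openin ?M S"
  show "openin weak_star S"
  proof (subst openin_subopen, intro ballI)
    fix \<mu> assume \<mu>: "\<mu> \<in> S"
    then obtain r where r: "r > 0" "invariant_measures.mball \<mu> r \<subseteq> S" and inv: "\<mu> \<in> invariant_measures"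
      using S unfolding invariant_measures.openin_mtopology by blast
    \<comment> \<open>With tolerance \<open>r / 4\<close> on the blocks shorter than
      \<open>N\<close>, \<open>measure_dist_leI\<close> bounds the distance by
      \<open>r / 2 + 2 * (1/2) ^ N\<close>, which is less than \<open>r\<close>.\<close>
    obtain N where N: "(1/2) ^ N < r / 4"
      using r(1) real_arch_pow_inv[of "r / 4" "1/2"] by auto
    define I where "I = (SIGMA n:{..N}. {..<CARD('a) ^ n})"
    define W where "W p = {\<nu> :: (int \<Rightarrow> 'a) measure. \<nu> \<in> invariant_measures \<and> measure \<nu> (block_set (fst p) (snd p)) \<in>
      ball (measure \<mu> (block_set (fst p) (snd p))) (r / 4)}" for p
    have "finite I" by (simp add: I_def)
    \<comment> \<open>The intersection below needs a nonempty index set; membership in a single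
      \<open>W p\<close> also shows that \<open>\<nu>\<close> is invariant.\<close>
    have "(0, 0) \<in> I" by (simp add: I_def)
    then have "I \<noteq> {}" by blast
    have "openin weak_star (W p)" for p
      unfolding W_def by (rule openin_weak_star_block_set[OF open_ball])
    then have "openin weak_star (\<Inter> (W ` I))"
      using \<open>finite I\<close> \<open>I \<noteq> {}\<close> by (intro openin_Inter) auto
    moreover have "\<mu> \<in> \<Inter> (W ` I)" using inv r(1) by (auto simp: W_def)
    moreover have "\<Inter> (W ` I) \<subseteq> S"
    proof
      fix \<nu> assume \<nu>: "\<nu> \<in> \<Inter> (W ` I)"
      then have inv': "\<nu> \<in> invariant_measures" using \<open>I \<noteq> {}\<close> by (auto simp: W_def)
      have "measure_dist \<mu> \<nu> \<le> 2 * (r / 4) + 2 * (1/2) ^ N"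
      proof (rule measure_dist_leI)
        fix n k assume "n < N" "k < CARD('a) ^ n"
        then have "(n, k) \<in> I" by (simp add: I_def)
        then have "\<nu> \<in> W (n, k)" using \<nu> by blast
        then show "\<bar>measure \<mu> (block_set n k) - measure \<nu> (block_set n k)\<bar> \<le> r / 4"
          by (simp add: W_def dist_real_def)
      qed (use inv inv' r(1) in \<open>auto intro: invariant_measuresD\<close>)
      also have "\<dots> < r" using N by simp
      finally have "\<nu> \<in> invariant_measures.mball \<mu> r"
        using inv inv' measure_dist_nonneg[of \<mu> \<nu>]
        by (simp add: invariant_measures.in_mball invariant_measuresD(1))
      then show "\<nu> \<in> S" using r(2) by blast
    qed
    ultimately show "\<exists>T. openin weak_star T \<and> \<mu> \<in> T \<and> T \<subseteq> S" by blast
  qed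
qed

section \<open>Sequential compactness of the invariant measures\<close>

lemma convergent_on_blocks_subsequence:
  fixes M :: "nat \<Rightarrow> (int \<Rightarrow> 'a::{finite,discrete_topology}) measure"
  assumes "\<And>i. prob_space (M i)"
  obtains r :: "nat \<Rightarrow> nat" and l where "strict_mono r"
    "\<And>n k. (\<lambda>i. measure (M (r i)) (block_set n k)) \<longlonglongrightarrow> l n k"
proof -
  define f :: "nat \<Rightarrow> nat \<times> nat \<Rightarrow> real"
    where "f i p = measure (M i) (block_set (fst p) (snd p))" for i p
  \<comment> \<open>Tychonoff replaces the diagonal argument: a product of unit intervals over the
    countable set of pairs is compact and metrizable, hence sequentially compact.\<close>
  have "compactin (product_topology (\<lambda>i::nat\<times>nat. euclidean :: real topology) UNIV) (Pi\<^sub>E UNIV (\<lambda>_. {0..1}))"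
    by (simp add: compactin_PiE compactin_euclidean_iff)
  then have "seq_compact (Pi\<^sub>E UNIV (\<lambda>_::nat\<times>nat. {0..1::real}))"
    by (simp add: euclidean_product_topology compactin_euclidean_iff compact_eq_seq_compact_metric)
  moreover have "f i \<in> Pi\<^sub>E UNIV (\<lambda>_. {0..1})" for i
    using assms by (auto simp: f_def prob_space.prob_le_1)
  ultimately obtain l r where r: "strict_mono r" "(f \<circ> r) \<longlonglongrightarrow> l"
    unfolding seq_compact_def by metis
  have "(\<lambda>i. measure (M (r i)) (block_set n k)) \<longlonglongrightarrow> l (n, k)" for n k
  proof -
    have "continuous_on UNIV (\<lambda>g :: nat \<times> nat \<Rightarrow> real. g (n, k))" by simp
    then have "isCont (\<lambda>g :: nat \<times> nat \<Rightarrow> real. g (n, k)) l"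
      unfolding continuous_on_eq_continuous_at[OF open_UNIV] by (rule bspec) simp
    from isCont_tendsto_compose[OF this r(2)] show ?thesis by (simp add: f_def)
  qed
  with r(1) show ?thesis using that[of r "\<lambda>n k. l (n, k)"] by blast
qed

lemma measure_dist_tendsto_0:
  fixes M :: "nat \<Rightarrow> (int \<Rightarrow> 'a::{finite,discrete_topology}) measure"
  assumes "\<And>i. prob_space (M i)" "prob_space \<mu>"
    and "\<And>n k. (\<lambda>i. measure (M i) (block_set n k)) \<longlonglongrightarrow> measure \<mu> (block_set n k)"
  shows "(\<lambda>i. measure_dist (M i) \<mu>) \<longlonglongrightarrow> 0"
proof (rule LIMSEQ_I)
  fix r :: real assume r: "r > 0"
  obtain N where N: "(1/2) ^ N < r / 4"
    using r(1) real_arch_pow_inv[of "r / 4" "1/2"] by auto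
  have "\<forall>\<^sub>F i in sequentially. \<bar>measure (M i) (block_set n k) - measure \<mu> (block_set n k)\<bar> < r / 4" for n k
    using tendstoD[OF assms(3), of "r / 4"] r by (simp add: dist_real_def)
  \<comment> \<open>Only finitely many blocks are shorter than \<open>N\<close>, so a single index
    \<open>i0\<close> serves them all.\<close>
  then have "\<forall>\<^sub>F i in sequentially. \<forall>n\<in>{..<N}. \<forall>k\<in>{..<CARD('a) ^ n}.
      \<bar>measure (M i) (block_set n k) - measure \<mu> (block_set n k)\<bar> < r / 4"
    by (intro eventually_ball_finite ballI) auto
  then obtain i0 where i0: "\<And>i n k. i \<ge> i0 \<Longrightarrow> n < N \<Longrightarrow> k < CARD('a) ^ n \<Longrightarrow>
      \<bar>measure (M i) (block_set n k) - measure \<mu> (block_set n k)\<bar> < r / 4"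
    unfolding eventually_sequentially by blast
  have "norm (measure_dist (M i) \<mu> - 0) < r" if "i \<ge> i0" for i
  proof -
    have "measure_dist (M i) \<mu> \<le> 2 * (r / 4) + 2 * (1/2) ^ N"
      using i0[OF that] r by (intro measure_dist_leI assms(1,2)) (auto intro: less_imp_le)
    then show ?thesis using N measure_dist_nonneg[OF assms(1,2), of i] by simp
  qed
  then show "\<exists>i0. \<forall>i\<ge>i0. norm (measure_dist (M i) \<mu> - 0) < r" by blast
qed

text \<open>Continuity at the empty set, the hypothesis of Caratheodory's theorem, is automatic on
  clopen sets: by compactness a decreasing sequence with empty intersection is eventually empty.\<close>

lemma decreasing_clopens_eventually_empty:
  fixes A :: "nat \<Rightarrow> (int \<Rightarrow> 'a::{finite,discrete_topology}) set"
  assumes "range A \<subseteq> clopens" "decseq A" "(\<Inter>i. A i) = {}"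
  obtains m where "\<And>i. i \<ge> m \<Longrightarrow> A i = {}"
proof -
  have cover: "UNIV \<subseteq> (\<Union>i\<in>UNIV. - A i)" using assms(3) by blast
  have "open (- A i)" for i using assms(1) by (auto simp: clopens_def open_Compl)
  then obtain C where C: "finite C" "UNIV \<subseteq> (\<Union>i\<in>C. - A i)"
    using compactE_image[OF compact_configs _ cover] by metis
  obtain m where m: "\<forall>i\<in>C. i \<le> m" using C(1) finite_nat_set_iff_bounded_le by auto
  have "A i = {}" if "i \<ge> m" for i
  proof -
    have "A i \<subseteq> A j" if "j \<in> C" for j
      using m that \<open>i \<ge> m\<close> by (intro decseqD[OF assms(2)]) auto
    then show ?thesis using C(2) by blast
  qed
  then show ?thesis by (rule that)
qed

lemma convergent_on_blocks_limit:
  fixes M :: "nat \<Rightarrow> (int \<Rightarrow> 'a::{finite,discrete_topology}) measure"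
  assumes inv: "\<And>i. M i \<in> invariant_measures"
    and conv: "\<And>n k. (\<lambda>i. measure (M i) (block_set n k)) \<longlonglongrightarrow> l n k"
  obtains \<mu> where "\<mu> \<in> invariant_measures" "(\<lambda>i. measure_dist (M i) \<mu>) \<longlonglongrightarrow> 0"
proof -
  note prob = inv[THEN invariant_measuresD(1)] and sets = inv[THEN invariant_measuresD(2)]
  note space = inv[THEN invariant_measuresD(3)]
  interpret algebra UNIV "clopens :: (int \<Rightarrow> 'a) set set" by (rule clopens_algebra)
  define \<phi> where "\<phi> E = lim (\<lambda>i. measure (M i) E)" for E
  have lim: "(\<lambda>i. measure (M i) E) \<longlonglongrightarrow> \<phi> E" if E: "E \<in> clopens" for E
  proof -
    obtain a n S where S: "finite S" "E = {x. block x a n \<in> S}" using clopen_eq_block_in[OF E] .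
    have "(\<lambda>i. \<Sum>k\<in>S. measure (M i) (block_set n k)) \<longlonglongrightarrow> (\<Sum>k\<in>S. l n k)"
      by (intro tendsto_sum conv)
    then have "(\<lambda>i. measure (M i) E) \<longlonglongrightarrow> (\<Sum>k\<in>S. l n k)"
      by (simp add: S measure_block_in[OF inv])
    then show ?thesis unfolding \<phi>_def by (simp add: limI)
  qed
  have clopen_sets: "E \<in> sets borel" if "E \<in> clopens" for E :: "(int \<Rightarrow> 'a) set"
    using that by (auto simp: clopens_def)
  have nonneg: "0 \<le> \<phi> E" if "E \<in> clopens" for E
    using lim[OF that] by (rule LIMSEQ_le_const) auto
  \<comment> \<open>Finite additivity passes to the limit termwise. Countable additivity need not,
    and is recovered from compactness through Caratheodory's theorem.\<close>
  have add: "\<phi> (A \<union> B) = \<phi> A + \<phi> B" if "A \<in> clopens" "B \<in> clopens" "A \<inter> B = {}" for A B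
  proof (rule LIMSEQ_unique)
    show "(\<lambda>i. measure (M i) (A \<union> B)) \<longlonglongrightarrow> \<phi> (A \<union> B)" using that by (intro lim) auto
    have "measure (M i) (A \<union> B) = measure (M i) A + measure (M i) B" for i
      using that prob by (intro finite_measure.finite_measure_Union)
        (auto simp: sets clopen_sets prob_space.axioms(1))
    then show "(\<lambda>i. measure (M i) (A \<union> B)) \<longlonglongrightarrow> \<phi> A + \<phi> B"
      using that by (auto intro!: tendsto_add lim)
  qed
  have empty: "\<phi> {} = 0" by (simp add: \<phi>_def)
  have "\<exists>m. (\<forall>E\<in>clopens. m E = ennreal (\<phi> E)) \<and> measure_space UNIV (sigma_sets UNIV clopens) m"
  proof (rule caratheodory_empty_continuous)
    show "positive clopens (\<lambda>E. ennreal (\<phi> E))" by (simp add: positive_def empty)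
    show "additive clopens (\<lambda>E. ennreal (\<phi> E))"
      by (auto simp: additive_def add nonneg ennreal_plus)
    fix A :: "nat \<Rightarrow> (int \<Rightarrow> 'a) set"
    assume "range A \<subseteq> clopens" "decseq A" "(\<Inter>i. A i) = {}"
    then obtain m where m: "\<And>i. i \<ge> m \<Longrightarrow> A i = {}"
      by (rule decreasing_clopens_eventually_empty) blast
    show "(\<lambda>i. ennreal (\<phi> (A i))) \<longlonglongrightarrow> 0"
      by (rule tendsto_eventually) (auto simp: eventually_sequentially m empty intro!: exI[of _ m])
  qed simp
  then obtain m where m: "\<And>E. E \<in> clopens \<Longrightarrow> m E = ennreal (\<phi> E)"
      "measure_space UNIV (sets (borel :: (int \<Rightarrow> 'a) measure)) m"
    unfolding sets_borel_clopens by blast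
  define \<mu> where "\<mu> = measure_of UNIV (sets borel) m"
  have sets_\<mu>: "sets \<mu> = sets borel"
    unfolding \<mu>_def using sets.sets_measure_of_eq[of "borel :: (int \<Rightarrow> 'a) measure"] by simp
  have space_\<mu>: "space \<mu> = UNIV" using sets_eq_imp_space_eq[OF sets_\<mu>] by simp
  have em: "emeasure \<mu> E = ennreal (\<phi> E)" if "E \<in> clopens" for E
    using m that unfolding \<mu>_def measure_space_def
    by (subst emeasure_measure_of_sigma) (auto simp: clopen_sets)
  have UNIV_clopen: "UNIV \<in> clopens" by (simp add: clopens_def)
  have "\<phi> UNIV = 1"
    using lim[OF UNIV_clopen] prob_space.prob_space[OF prob] by (simp add: space LIMSEQ_const_iff)
  then interpret \<mu>: prob_space \<mu> by (intro prob_spaceI) (simp add: em space_\<mu> UNIV_clopen)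
  have meas: "measure \<mu> E = \<phi> E" if "E \<in> clopens" for E
    using em[OF that] nonneg[OF that] by (simp add: measure_def)
  have "distr \<mu> borel shift = \<mu>"
  proof (rule measure_eqI_clopens)
    show "finite_measure (distr \<mu> borel shift)"
      by (intro \<mu>.finite_measure_distr shift_measurable sets_\<mu>)
    fix E :: "(int \<Rightarrow> 'a) set" assume E: "E \<in> clopens"
    have vE: "shift -` E \<in> clopens"
      using E by (simp add: clopens_def open_vimage closed_vimage continuous_shift)
    have "measure (distr \<mu> borel shift) E = measure \<mu> (shift -` E)"
      using clopen_sets[OF E] shift_measurable[OF sets_\<mu>] by (subst measure_distr) (auto simp: space_\<mu>)
    \<comment> \<open>Each \<open>M i\<close> is invariant, so the two limits are taken of the same
      sequence.\<close>
    moreover have "\<phi> (shift -` E) = \<phi> E"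
      unfolding \<phi>_def by (simp add: measure_vimage_shift[OF inv clopen_sets[OF E]])
    ultimately show "measure (distr \<mu> borel shift) E = measure \<mu> E"
      using E vE by (simp add: meas)
  qed (simp_all add: sets_\<mu> \<mu>.finite_measure_axioms)
  then have "\<mu> \<in> invariant_measures"
    by (simp add: invariant_measures_def sets_\<mu> \<mu>.prob_space_axioms)
  moreover have "block_set n k \<in> (clopens :: (int \<Rightarrow> 'a) set set)" for n k
    by (simp add: clopens_def block_set_def clopen_block)
  then have "(\<lambda>i. measure_dist (M i) \<mu>) \<longlonglongrightarrow> 0"
    by (intro measure_dist_tendsto_0 prob \<mu>.prob_space_axioms) (simp add: meas lim)
  ultimately show ?thesis by (rule that)
qed

lemma compact_space_invariant_measures:
  "compact_space (invariant_measures.mtopology :: (int \<Rightarrow> 'a::{finite,discrete_topology}) measure topology)"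
  unfolding invariant_measures.compact_space_sequentially
proof (intro allI impI)
  fix M :: "nat \<Rightarrow> (int \<Rightarrow> 'a) measure" assume "range M \<subseteq> invariant_measures"
  then have inv: "M i \<in> invariant_measures" for i by blast
  obtain r :: "nat \<Rightarrow> nat" and l where r: "strict_mono r"
      "\<And>n k. (\<lambda>i. measure (M (r i)) (block_set n k)) \<longlonglongrightarrow> l n k"
    using convergent_on_blocks_subsequence[of M] invariant_measuresD(1)[OF inv] by blast
  obtain \<mu> where \<mu>: "\<mu> \<in> invariant_measures" "(\<lambda>i. measure_dist (M (r i)) \<mu>) \<longlonglongrightarrow> 0"
    using convergent_on_blocks_limit[OF _ r(2)] inv by blast
  have "limitin invariant_measures.mtopology (M \<circ> r) \<mu> sequentially"
    unfolding invariant_measures.limitin_metric_dist_null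
    using \<mu> inv tendsto_rabs_zero[OF \<mu>(2)] by (simp add: comp_def)
  then show "\<exists>\<mu> r. \<mu> \<in> invariant_measures \<and> strict_mono r \<and>
      limitin invariant_measures.mtopology (M \<circ> r) \<mu> sequentially"
    using \<mu>(1) r(1) by blast
qed

section \<open>Limit points and averages\<close>

text \<open>Visits within \<open>1 / Suc n\<close> of \<open>l\<close> at ever later times, chosen
  one after the other, form the convergent subsequence. The criterion by recurrent visits avoids
  subsequences in the arguments that follow.\<close>

lemma (in Metric_space) sequence_limit_points_iff:
  assumes "range x \<subseteq> M"
  shows "l \<in> sequence_limit_points mtopology x \<longleftrightarrow> l \<in> M \<and> (\<forall>\<epsilon>>0. \<forall>n. \<exists>t\<ge>n. d (x t) l < \<epsilon>)"
proof (intro iffI conjI allI impI)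
  assume "l \<in> sequence_limit_points mtopology x"
  then obtain r :: "nat \<Rightarrow> nat" where r: "strict_mono r" "limitin mtopology (x \<circ> r) l sequentially"
    by (auto simp: sequence_limit_points_def)
  then show "l \<in> M" by (meson limitin_mspace)
  fix \<epsilon> :: real and n :: nat assume "\<epsilon> > 0"
  then obtain N where N: "\<And>m. m \<ge> N \<Longrightarrow> d (x (r m)) l < \<epsilon>"
    using r(2) unfolding limit_metric_sequentially comp_def by blast
  show "\<exists>t\<ge>n. d (x t) l < \<epsilon>"
    using N[of "max N n"] seq_suble[OF r(1), of "max N n"] by (intro exI[of _ "r (max N n)"]) auto
next
  assume l: "l \<in> M \<and> (\<forall>\<epsilon>>0. \<forall>n. \<exists>t\<ge>n. d (x t) l < \<epsilon>)"
  have "\<exists>r::nat\<Rightarrow>nat. \<forall>n. d (x (r n)) l < 1 / Suc n \<and> r n < r (Suc n)"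
  proof (rule dependent_nat_choice)
    show "\<exists>t. d (x t) l < 1 / Suc 0" using l by (metis divide_self_if zero_less_one of_nat_1 One_nat_def zero_neq_one)
    fix t n
    have "0 < 1 / real (Suc (Suc n))" by simp
    then obtain s where "s \<ge> Suc t" "d (x s) l < 1 / Suc (Suc n)" using l by blast
    then show "\<exists>s. d (x s) l < 1 / Suc (Suc n) \<and> t < s" by (auto simp: Suc_le_eq)
  qed
  then obtain r :: "nat \<Rightarrow> nat" where r: "\<And>n. d (x (r n)) l < 1 / Suc n" "\<And>n. r n < r (Suc n)"
    by blast
  have "(\<lambda>n. d (x (r n)) l) \<longlonglongrightarrow> 0"
    by (rule tendsto_sandwich[OF _ _ tendsto_const LIMSEQ_inverse_real_of_nat])
      (use r(1) in \<open>auto intro!: always_eventually less_imp_le simp: inverse_eq_divide\<close>)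
  then have "limitin mtopology (x \<circ> r) l sequentially"
    using l by (simp add: limitin_metric_dist_null comp_def range_subsetD[OF assms])
  moreover have "strict_mono r" using r(2) by (simp add: strict_mono_Suc_iff)
  ultimately show "l \<in> sequence_limit_points mtopology x" by (auto simp: sequence_limit_points_def)
qed

lemma (in Metric_space) closedin_sequence_limit_points:
  assumes "range x \<subseteq> M"
  shows "closedin mtopology (sequence_limit_points mtopology x)"
  unfolding closedin_metric
proof (intro conjI allI impI)
  show "sequence_limit_points mtopology x \<subseteq> M" by (auto simp: sequence_limit_points_iff[OF assms])
  fix l assume l: "l \<in> M - sequence_limit_points mtopology x"
  then obtain \<epsilon> n where \<epsilon>: "\<epsilon> > 0" "\<And>t. t \<ge> n \<Longrightarrow> \<epsilon> \<le> d (x t) l"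
    by (auto simp: sequence_limit_points_iff[OF assms] not_less)
  have "l' \<notin> sequence_limit_points mtopology x" if "l' \<in> mball l (\<epsilon>/2)" for l'
  proof
    assume "l' \<in> sequence_limit_points mtopology x"
    then obtain t where "t \<ge> n" "d (x t) l' < \<epsilon>/2"
      using half_gt_zero[OF \<epsilon>(1)] unfolding sequence_limit_points_iff[OF assms] by blast
    then show False
      using \<epsilon>(2)[of t] that triangle[of "x t" l' l] assms by (auto simp: in_mball commute[of l])
  qed
  then have "disjnt (sequence_limit_points mtopology x) (mball l (\<epsilon>/2))"
    unfolding disjnt_iff by blast
  then show "\<exists>r>0. disjnt (sequence_limit_points mtopology x) (mball l r)"
    using half_gt_zero[OF \<epsilon>(1)] by blast
qed

lemma (in Metric_space) sequence_limit_points_nonempty: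
  assumes "compact_space mtopology" "range x \<subseteq> M"
  shows "sequence_limit_points mtopology x \<noteq> {}"
  using assms unfolding compact_space_sequentially sequence_limit_points_def by blast

text \<open>Two errors of size \<open>e i\<close> make up the slack: one because \<open>x t\<close>
  only comes close to the limit point, one because \<open>D i t\<close> only approximates the
  distance. As \<open>e\<close> tends to 0, the slack is lost in the limit and the closed ball of
  radius exactly \<open>r\<close> reappears.\<close>

lemma (in Metric_space) sequence_limit_points_meet_cball_iff:
  fixes e :: "nat \<Rightarrow> real"
  assumes compact: "compact_space mtopology" and x: "range x \<subseteq> M" and c: "c \<in> M"
    and e: "\<And>i. 0 < e i" "e \<longlonglongrightarrow> 0" and D: "\<And>i t. \<bar>D i t - d c (x t)\<bar> \<le> e i"
  shows "(\<exists>l\<in>sequence_limit_points mtopology x. d c l \<le> r) \<longleftrightarrow> (\<forall>i. \<exists>t\<ge>i. D i t \<le> r + 2 * e i)"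
proof
  assume "\<exists>l\<in>sequence_limit_points mtopology x. d c l \<le> r"
  then obtain l where l: "l \<in> M" "\<And>\<epsilon> n. \<epsilon> > 0 \<Longrightarrow> \<exists>t\<ge>n. d (x t) l < \<epsilon>" "d c l \<le> r"
    using sequence_limit_points_iff[OF x] by auto
  show "\<forall>i. \<exists>t\<ge>i. D i t \<le> r + 2 * e i"
  proof
    fix i
    obtain t where t: "t \<ge> i" "d (x t) l < e i" using l(2) e(1) by blast
    have "d c (x t) \<le> d c l + d l (x t)" using c l(1) x by (intro triangle) auto
    then have "D i t \<le> r + 2 * e i" using D[of i t] l(3) t(2) commute[of l "x t"] by linarith
    then show "\<exists>t\<ge>i. D i t \<le> r + 2 * e i" using t(1) by blast
  qed
next
  assume "\<forall>i. \<exists>t\<ge>i. D i t \<le> r + 2 * e i"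
  then obtain t where t: "\<And>i. t i \<ge> i" "\<And>i. D i (t i) \<le> r + 2 * e i" by metis
  have "range (x \<circ> t) \<subseteq> M" using x by auto
  then obtain l s where l: "l \<in> M" and s: "strict_mono (s :: nat \<Rightarrow> nat)"
      and lim: "limitin mtopology ((x \<circ> t) \<circ> s) l sequentially"
    using compact unfolding compact_space_sequentially by blast
  \<comment> \<open>The composition of \<open>t\<close> and \<open>s\<close> need not be increasing,
    hence need not index a subsequence of \<open>x\<close>. Since \<open>t i \<ge> i\<close>, it
    still yields arbitrarily late visits near \<open>l\<close>.\<close>
  have "\<exists>m\<ge>n. d (x m) l < \<epsilon>" if pos: "\<epsilon> > 0" for \<epsilon> n
  proof -
    obtain N where N: "\<And>m. m \<ge> N \<Longrightarrow> d (x (t (s m))) l < \<epsilon>"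
      using lim pos unfolding limit_metric_sequentially comp_def by blast
    let ?m = "max N n"
    have "n \<le> t (s ?m)" using t(1)[of "s ?m"] seq_suble[OF s, of ?m] by linarith
    then show ?thesis using N[of ?m] by auto
  qed
  then have "l \<in> sequence_limit_points mtopology x" using l by (simp add: sequence_limit_points_iff[OF x])
  moreover have "d c l \<le> r"
  proof (rule LIMSEQ_le_const)
    have "(\<lambda>n. d (x (t (s n))) l) \<longlonglongrightarrow> 0" using lim by (simp add: limitin_metric_dist_null comp_def)
    moreover have "(\<lambda>n. e (s n)) \<longlonglongrightarrow> 0" using LIMSEQ_subseq_LIMSEQ[OF e(2) s] by (simp add: comp_def)
    ultimately have "(\<lambda>n. r + 3 * e (s n) + d (x (t (s n))) l) \<longlonglongrightarrow> r + 3 * 0 + 0"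
      by (intro tendsto_intros)
    then show "(\<lambda>n. r + 3 * e (s n) + d (x (t (s n))) l) \<longlonglongrightarrow> r" by simp
    \<comment> \<open>Of the three errors, two are the slack of the test and one is the error of
      \<open>D\<close>.\<close>
    have "d c l \<le> r + 3 * e (s n) + d (x (t (s n))) l" for n
      using triangle[of c "x (t (s n))" l] c l x D[of "s n" "t (s n)"] t(2)[of "s n"] by fastforce
    then show "\<exists>N. \<forall>n\<ge>N. d c l \<le> r + 3 * e (s n) + d (x (t (s n))) l" by blast
  qed
  ultimately show "\<exists>l\<in>sequence_limit_points mtopology x. d c l \<le> r" by blast
qed

section \<open>Averages and periodic measures\<close>

lemma sets_average_measure: "sets (average_measure n M) = sets borel"
  unfolding average_measure_def
  using sets.sets_measure_of_eq[of "borel :: (int \<Rightarrow> 'a::{finite,discrete_topology}) measure"] by simp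

lemma measure_average_measure:
  fixes M :: "nat \<Rightarrow> (int \<Rightarrow> 'a::{finite,discrete_topology}) measure"
  assumes "\<And>i. i < n \<Longrightarrow> prob_space (M i)" "\<And>i. i < n \<Longrightarrow> sets (M i) = sets borel"
    and "E \<in> sets borel" "0 < n"
  shows "measure (average_measure n M) E = (\<Sum>i<n. measure (M i) E) / n"
    and "emeasure (average_measure n M) E = ennreal ((\<Sum>i<n. measure (M i) E) / n)"
proof -
  have "(\<Sum>i<n. emeasure (M i) E) = (\<Sum>i<n. ennreal (measure (M i) E))"
    using assms(1) by (intro sum.cong refl finite_measure.emeasure_eq_measure) (auto simp: prob_space.axioms(1))
  also have "\<dots> = ennreal (\<Sum>i<n. measure (M i) E)" by (rule sum_ennreal) simp
  finally have sum: "(\<Sum>i<n. emeasure (M i) E) = ennreal (\<Sum>i<n. measure (M i) E)" .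
  have avg: "emeasure (average_measure n M) E = (\<Sum>i<n. emeasure (M i) E) / of_nat n"
    by (intro emeasure_average_measure assms(2,3))
  show "emeasure (average_measure n M) E = ennreal ((\<Sum>i<n. measure (M i) E) / n)"
    unfolding avg sum ennreal_of_nat_eq_real_of_nat
    using assms(4) by (intro divide_ennreal sum_nonneg) auto
  then show "measure (average_measure n M) E = (\<Sum>i<n. measure (M i) E) / n"
    by (simp add: measure_def[of "average_measure n M"] sum_nonneg)
qed

lemma prob_space_average_measure:
  fixes M :: "nat \<Rightarrow> (int \<Rightarrow> 'a::{finite,discrete_topology}) measure"
  assumes "\<And>i. i < n \<Longrightarrow> prob_space (M i)" "\<And>i. i < n \<Longrightarrow> sets (M i) = sets borel" "0 < n"
  shows "prob_space (average_measure n M)"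
proof
  have "measure (M i) UNIV = 1" if "i < n" for i
    using prob_space.prob_space[OF assms(1)[OF that]] sets_eq_imp_space_eq[OF assms(2)[OF that]] by simp
  then have "emeasure (average_measure n M) UNIV = 1"
    using assms(3) by (subst measure_average_measure(2)[OF assms(1,2)]) auto
  then show "emeasure (average_measure n M) (space (average_measure n M)) = 1"
    using sets_eq_imp_space_eq[OF sets_average_measure[of n M]] by simp
qed

lemma invariant_measuresI:
  fixes \<mu> :: "(int \<Rightarrow> 'a::{finite,discrete_topology}) measure"
  assumes "prob_space \<mu>" "sets \<mu> = sets borel"
    and "\<And>E. E \<in> sets borel \<Longrightarrow> shift -` E \<in> sets borel \<Longrightarrow> measure \<mu> (shift -` E) = measure \<mu> E"
  shows "\<mu> \<in> invariant_measures"
proof -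
  interpret prob_space \<mu> by fact
  have space: "space \<mu> = UNIV" using sets_eq_imp_space_eq[OF assms(2)] by simp
  have "distr \<mu> borel shift = \<mu>"
  proof (rule measure_eqI_clopens)
    show "finite_measure (distr \<mu> borel shift)"
      by (intro finite_measure_distr shift_measurable assms)
    fix E :: "(int \<Rightarrow> 'a) set" assume "E \<in> clopens"
    then have E: "E \<in> sets borel" by (auto simp: clopens_def)
    have "shift -` E \<inter> space borel \<in> sets borel"
      by (rule measurable_sets[OF shift_measurable[OF refl] E])
    then have "measure \<mu> (shift -` E) = measure \<mu> E" using assms(3)[OF E] by simp
    then show "measure (distr \<mu> borel shift) E = measure \<mu> E"
      by (simp add: measure_distr[OF shift_measurable[OF assms(2)] E] space)
  qed (simp_all add: assms finite_measure_axioms)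
  then show ?thesis by (simp add: invariant_measures_def assms)
qed

lemma average_measure_invariant:
  fixes M :: "nat \<Rightarrow> (int \<Rightarrow> 'a::{finite,discrete_topology}) measure"
  assumes "\<And>i. i < n \<Longrightarrow> M i \<in> invariant_measures" "0 < n"
  shows "average_measure n M \<in> invariant_measures"
proof (rule invariant_measuresI)
  note inv = invariant_measuresD[OF assms(1)]
  show "prob_space (average_measure n M)"
    using assms(2) inv by (intro prob_space_average_measure)
  fix E :: "(int \<Rightarrow> 'a) set" assume "E \<in> sets borel" "shift -` E \<in> sets borel"
  then show "measure (average_measure n M) (shift -` E) = measure (average_measure n M) E"
    using assms inv by (simp add: measure_average_measure measure_vimage_shift)
qed (rule sets_average_measure)

lemma measure_periodic_measure:
  fixes w :: "'a::{finite,discrete_topology} list"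
  assumes "w \<noteq> []" "E \<in> sets borel"
  shows "measure (periodic_measure w) E =
    (\<Sum>i<length w. of_bool ((shift ^^ i) (periodic_config w) \<in> E)) / length w"
  unfolding periodic_measure_def using assms
  by (subst measure_average_measure)
    (auto intro!: prob_space_return simp: measure_return indicator_def)

lemma funpow_shift_periodic_config:
  assumes "w \<noteq> []"
  shows "(shift ^^ i) (periodic_config w) j = w ! nat ((j + int i) mod int (length w))"
  by (simp add: funpow_shift periodic_config_def)

lemma periodic_measure_invariant:
  fixes w :: "'a::{finite,discrete_topology} list"
  assumes "w \<noteq> []"
  shows "periodic_measure w \<in> invariant_measures"
proof (rule invariant_measuresI)
  show "prob_space (periodic_measure w)"
    unfolding periodic_measure_def using assms
    by (intro prob_space_average_measure) (auto intro!: prob_space_return)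
  show "sets (periodic_measure w) = sets borel"
    unfolding periodic_measure_def by (rule sets_average_measure)
  fix E :: "(int \<Rightarrow> 'a) set" assume E: "E \<in> sets borel" "shift -` E \<in> sets borel"
  define f where "f i = (of_bool ((shift ^^ i) (periodic_config w) \<in> E) :: real)" for i
  \<comment> \<open>After a full period the orbit closes up, so shifting the index of the sum only
    exchanges its first term for an equal last one.\<close>
  have "(shift ^^ length w) (periodic_config w) = periodic_config w"
    by (rule ext) (simp add: funpow_shift periodic_config_def)
  then have "f (length w) = f 0" by (simp add: f_def)
  then have "(\<Sum>i<length w. f (Suc i)) = (\<Sum>i<length w. f i)"
    using sum.lessThan_Suc[of f "length w"] sum.lessThan_Suc_shift[of f "length w"] by simp
  then show "measure (periodic_measure w) (shift -` E) = measure (periodic_measure w) E"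
    by (simp add: measure_periodic_measure assms E f_def)
qed

text \<open>Translates a digit into the number under which \<open>word_code\<close> knows the
  letter. The result type does not mention the alphabet, hence the type argument.\<close>

definition letter_code :: "'a::finite itself \<Rightarrow> nat \<Rightarrow> nat" where
  "letter_code _ i = to_nat (letter i :: 'a)"

lemma computable_letter_code [computable]:
  assumes "computable_from gs a" "\<And>e. a e < CARD('a::finite)"
  shows "computable_from gs (\<lambda>e. letter_code TYPE('a) (a e))"
  using assms by (rule computable_finite_table)

text \<open>A list code grows at the head, so the recursion runs from the last letter back to the
  first and prepends the digit \<open>n - Suc m\<close> in step \<open>m\<close>.\<close>

lemma word_code_nat_word:
  "word_code (nat_word n k :: 'a::finite list) =
    rec_nat 0 (\<lambda>m y. Suc (prod_encode (letter_code TYPE('a) (k div CARD('a) ^ (n - Suc m) mod CARD('a)), y))) n"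
proof -
  define c where "c i = letter_code TYPE('a) (k div CARD('a) ^ i mod CARD('a))" for i
  have "rec_nat 0 (\<lambda>m y. Suc (prod_encode (c (n - Suc m), y))) m = list_encode (map c [n - m..<n])"
    if "m \<le> n" for m
    using that
  proof (induction m)
    case (Suc m)
    then have "[n - Suc m..<n] = (n - Suc m) # [n - m..<n]" by (simp add: upt_rec Suc_diff_Suc)
    with Suc show ?case by simp
  qed simp
  from this[of n] show ?thesis
    by (simp add: c_def[abs_def] word_code_def nat_word_def nat_config_def letter_code_def comp_def)
qed

lemma computable_word_code_nat_word [computable]:
  assumes "computable_from gs a" "computable_from gs b"
  shows "computable_from gs (\<lambda>e. word_code (nat_word (a e) (b e) :: 'a::finite list))"
  unfolding word_code_nat_word
  by (rule computable assms | (rule computable_from_lift[OF assms(1)], force; fail) |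
      (rule computable_from_lift[OF assms(2)], force; fail) |
      (rule computable_from_member, simp; fail) | (simp add: card_gt_0_iff; fail))+

text \<open>\<^const>\<open>int_encode\<close> maps nonnegative \<open>a\<close> to \<open>2 * a\<close> and negative integers to odd numbers, so the
  parity test is a sign test.\<close>

definition dyadic_approx :: "nat \<Rightarrow> nat \<Rightarrow> nat" where
  "dyadic_approx c p = (let a = fst (prod_decode c); b = snd (prod_decode c) in
     if a mod 2 = 0 then (a div 2 * 2 ^ p) div b else 0)"

lemma computable_dyadic_approx [computable]:
  assumes "computable_from gs a" "computable_from gs b"
  shows "computable_from gs (\<lambda>e. dyadic_approx (a e) (b e))"
  unfolding dyadic_approx_def Let_def by (rule computable assms)+

lemma real_div_nat_bounds:
  fixes m n :: nat
  assumes "0 < n"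
  shows "real (m div n) \<le> real m / n" "real m / n \<le> real (m div n) + 1"
proof -
  show "real (m div n) \<le> real m / n" by (rule of_nat_div_le_of_nat)
  have "m < (m div n + 1) * n" using assms by (metis dividend_less_div_times add.commute mult_Suc plus_1_eq_Suc)
  then have "real m < (real (m div n) + 1) * n" by (metis of_nat_less_iff of_nat_mult of_nat_add of_nat_1)
  then show "real m / n \<le> real (m div n) + 1" using assms by (simp add: field_simps)
qed

lemma rat_code_components:
  fixes r :: rat
  obtains A B where "0 < B" "snd (prod_decode (rat_code r)) = B"
    "fst (prod_decode (rat_code r)) mod 2 = 0 \<longleftrightarrow> 0 \<le> r"
    "0 \<le> r \<longrightarrow> fst (prod_decode (rat_code r)) div 2 = A \<and> of_rat r = real A / real B"
proof -
  obtain a b where q: "quotient_of r = (a, b)" by fastforce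
  have b: "b > 0" using quotient_of_denom_pos[OF q] .
  have r: "r = of_int a / of_int b" using quotient_of_div[OF q] .
  have sign: "0 \<le> r \<longleftrightarrow> 0 \<le> a" using b by (simp add: r zero_le_divide_iff)
  have code: "fst (prod_decode (rat_code r)) = int_encode a" "snd (prod_decode (rat_code r)) = nat b"
    by (simp_all add: rat_code_def q)
  show ?thesis
  proof (rule that[of "nat b" "nat a"])
    show "fst (prod_decode (rat_code r)) mod 2 = 0 \<longleftrightarrow> 0 \<le> r"
      by (auto simp: code sign int_encode_def sum_encode_def)
    have "of_rat r = real (nat a) / real (nat b)" if "0 \<le> a"
      using b that by (simp add: r of_rat_divide)
    then show "0 \<le> r \<longrightarrow> fst (prod_decode (rat_code r)) div 2 = nat a \<and>
        of_rat r = real (nat a) / real (nat b)"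
      using sign by (simp add: code int_encode_def sum_encode_def)
  qed (use b code in auto)
qed

text \<open>One unit comes from the given approximation, scaled by \<open>2 ^ p\<close>, and one
  from the rounded division. A negative \<open>q\<close> may be replaced by 0, because then
  \<open>m * 2 ^ p\<close> lies between 0 and 1.\<close>

lemma dyadic_approx_rat_code:
  assumes "0 \<le> m" "\<bar>m - of_rat q\<bar> < (1/2) ^ p"
  shows "\<bar>m * 2 ^ p - real (dyadic_approx (rat_code q) p)\<bar> \<le> 2"
proof -
  obtain A B where AB: "0 < B" "snd (prod_decode (rat_code q)) = B"
    "fst (prod_decode (rat_code q)) mod 2 = 0 \<longleftrightarrow> 0 \<le> q"
    "0 \<le> q \<longrightarrow> fst (prod_decode (rat_code q)) div 2 = A \<and> of_rat q = real A / real B"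
    using rat_code_components[of q] .
  have "\<bar>m - of_rat q\<bar> * 2 ^ p < (1/2) ^ p * 2 ^ p"
    using assms(2) by (intro mult_strict_right_mono) auto
  then have close: "\<bar>m * 2 ^ p - of_rat q * 2 ^ p\<bar> < 1"
    by (simp add: abs_mult flip: left_diff_distrib power_mult_distrib)
  show ?thesis
  proof (cases "0 \<le> q")
    case True
    then have "dyadic_approx (rat_code q) p = A * 2 ^ p div B" using AB by (simp add: dyadic_approx_def)
    moreover have "of_rat q * 2 ^ p = real (A * 2 ^ p) / B" using AB(4) True by simp
    ultimately show ?thesis using close real_div_nat_bounds[OF AB(1), of "A * 2 ^ p"] by linarith
  next
    case False
    then have "of_rat q * 2 ^ p \<le> (0 :: real)" by (simp add: mult_nonpos_nonneg)
    moreover have "dyadic_approx (rat_code q) p = 0" using False AB by (simp add: dyadic_approx_def)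
    moreover have "0 \<le> m * 2 ^ p" using assms(1) by simp
    ultimately show ?thesis using close by linarith
  qed
qed

section \<open>Cellular automata on block codes\<close>

lemma computable_funpow_param:
  assumes f: "computable_from [fst, snd] (\<lambda>x. f (fst x) (snd x))"
    and "computable_from gs N" "computable_from gs t" "computable_from gs j"
  shows "computable_from gs (\<lambda>e. (f (N e) ^^ t e) (j e))"
proof -
  note [computable] = assms(2-4) computable_from_compose2[OF f]
  have "computable_from gs (\<lambda>e. rec_nat (j e) (\<lambda>n y. f (N e) y) (t e))"
    by (rule computable | (rule computable_from_lift[OF assms(2)], force; fail) |
      (rule computable_from_member, simp; fail))+
  moreover have "rec_nat m (\<lambda>n y. g y) k = (g ^^ k) m" for g and m :: nat and k by (induction k) auto
  ultimately show ?thesis by simp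
qed

text \<open>The shift is invertible, so commuting with it extends to all integer powers; one rule at
  position 0 then describes \<open>F\<close> everywhere.\<close>

lemma commute_all_shifts:
  assumes "\<And>x. F (shift x) = shift (F x)"
  shows "F x i = F (\<lambda>j. x (j + i)) 0"
proof -
  have "F (\<lambda>j. x (j + i)) = (\<lambda>j. F x (j + i))"
  proof (induction i rule: int_induct[where k = 0])
    case (step1 i)
    have "F (\<lambda>j. x (j + (i + 1))) = F (shift (\<lambda>j. x (j + i)))" by (simp add: shift_def ac_simps)
    then show ?case by (simp add: assms step1) (simp add: shift_def ac_simps)
  next
    case (step2 i)
    have "shift (F (\<lambda>j. x (j + (i - 1)))) = F (\<lambda>j. x (j + i))"
      by (simp add: assms[symmetric]) (simp add: shift_def)
    then have "shift (F (\<lambda>j. x (j + (i - 1)))) (j - 1) = F x (j - 1 + i)" for j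
      by (simp add: step2)
    then show ?case by (auto simp: shift_def algebra_simps)
  qed simp
  then show ?thesis by simp
qed

text \<open>The Curtis-Hedlund-Lyndon theorem: the coordinate 0 of the image is a continuous
  function into a discrete space, so it depends on one finite window. For a number that codes no
  window, \<open>G\<close> takes the image of an arbitrary configuration, so it is total with values
  below the number of letters.\<close>

lemma cellular_automaton_local_rule:
  fixes F :: "(int \<Rightarrow> 'a::{finite,discrete_topology}) \<Rightarrow> (int \<Rightarrow> 'a)"
  assumes "cellular_automaton F"
  obtains R :: nat and G :: "nat \<Rightarrow> nat" where "\<And>j. G j < CARD('a)"
    "\<And>x i. digit (F x i) = G (block x (i - int R) (2 * R + 1))"
proof -
  have cont: "continuous_on UNIV F" and comm: "\<And>x. F (shift x) = shift (F x)"
    using assms by (auto simp: cellular_automaton_def)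
  obtain R :: nat where R: "\<And>x y. (\<And>i. \<bar>i\<bar> \<le> int R \<Longrightarrow> x i = y i) \<Longrightarrow> F x 0 = F y 0"
  proof (rule uniform_locality[of "\<lambda>x y. F x 0 = F y 0"])
    fix x
    have "continuous_on UNIV (\<lambda>x. F x 0)"
      using continuous_on_product_then_coordinatewise[OF cont] .
    then have "open ((\<lambda>x. F x 0) -` {F x 0})"
      by (intro open_vimage discrete_topology_class.open_discrete)
    then show "\<exists>U. open U \<and> x \<in> U \<and> (\<forall>y\<in>U. \<forall>z\<in>U. F y 0 = F z 0)"
      by (intro exI[of _ "(\<lambda>x. F x 0) -` {F x 0}"]) auto
  qed blast
  define G where "G j = digit (F (SOME x. block x (- int R) (2 * R + 1) = j) 0)" for j
  have "digit (F x i) = G (block x (i - int R) (2 * R + 1))" for x i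
  proof -
    define y where "y = (\<lambda>j. x (j + i))"
    have y: "block y (- int R) (2 * R + 1) = block x (i - int R) (2 * R + 1)"
      by (intro block_eqI) (simp add: y_def algebra_simps)
    define z :: "int \<Rightarrow> 'a" where "z = (SOME z. block z (- int R) (2 * R + 1) = block x (i - int R) (2 * R + 1))"
    have "block z (- int R) (2 * R + 1) = block x (i - int R) (2 * R + 1)"
      unfolding z_def
      by (rule someI[of "\<lambda>z. block z (- int R) (2 * R + 1) = block x (i - int R) (2 * R + 1)" y, OF y])
    then have "F z 0 = F y 0" using y by (intro R) (metis block_centered)
    then show ?thesis using commute_all_shifts[of F x i, OF comm] by (simp add: G_def z_def y_def)
  qed
  moreover have "G j < CARD('a)" for j unfolding G_def by (rule digit_less)
  ultimately show ?thesis using that[of G R] by blast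
qed

text \<open>The windows of the last \<open>2 * R\<close> digits stick out of the block, so these digits are meaningless;
  below they are always cut off by a modulus.\<close>

definition local_step :: "nat \<Rightarrow> nat \<Rightarrow> (nat \<Rightarrow> nat) \<Rightarrow> nat \<Rightarrow> nat \<Rightarrow> nat" where
  "local_step q R G N j = (\<Sum>i<N. G (j div q ^ i mod q ^ (2 * R + 1)) * q ^ i)"

lemma computable_local_step:
  assumes "0 < q"
  shows "computable_from [fst, snd] (\<lambda>x. local_step q R G (fst x) (snd x))"
  unfolding local_step_def
  by (rule computable computable_finite_table[where h = G and N = "q ^ (2 * R + 1)"] |
    (rule computable_from_member, simp; fail) | (simp add: assms; fail))+

locale local_rule =
  fixes F :: "(int \<Rightarrow> 'a::finite) \<Rightarrow> (int \<Rightarrow> 'a)" and R :: nat and G :: "nat \<Rightarrow> nat"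
  assumes G_less: "G j < CARD('a)"
    and local_rule: "digit (F x i) = G (block x (i - int R) (2 * R + 1))"
begin

text \<open>The window of the cell at \<open>a + R\<close> begins at \<open>a\<close>, hence the
  displacement. Only the \<open>M\<close> lowest digits of \<open>j\<close> are assumed correct:
  wrong digits invade from the top, \<open>2 * R\<close> of them per step.\<close>

lemma local_step_block:
  assumes "j mod CARD('a) ^ M = block x a M" "m + 2 * R \<le> M" "m \<le> N"
  shows "local_step CARD('a) R G N j mod CARD('a) ^ m = block (F x) (a + int R) m"
proof -
  let ?q = "CARD('a)"
  define f where "f i = G (j div ?q ^ i mod ?q ^ (2 * R + 1))" for i
  obtain d where N: "N = m + d" using assms(3) le_Suc_ex by blast
  have "local_step CARD('a) R G N j = (\<Sum>i<m. f i * ?q ^ i) + ?q ^ m * (\<Sum>i<d. f (m + i) * ?q ^ i)"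
    unfolding local_step_def f_def[symmetric] N by (rule digits_add)
  moreover have "(\<Sum>i<m. f i * ?q ^ i) < ?q ^ m" by (rule digits_less) (simp add: f_def G_less)
  ultimately have "local_step CARD('a) R G N j mod ?q ^ m = (\<Sum>i<m. f i * ?q ^ i)" by simp
  also have "\<dots> = block (F x) (a + int R) m"
    unfolding block_def
  proof (intro sum.cong refl arg_cong2[where f = "(*)"])
    fix i assume "i \<in> {..<m}"
    then have "j div ?q ^ i mod ?q ^ (2 * R + 1) = block x (a + int i) (2 * R + 1)"
      using assms(2) by (intro block_div_mod[OF _ assms(1)]) auto
    then show "f i = digit (F x (a + int R + int i))" by (simp add: f_def local_rule algebra_simps)
  qed
  finally show ?thesis .
qed

text \<open>The losses add up to \<open>2 * t * R\<close> digits and the displacements to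
  \<open>t * R\<close>. The number \<open>M\<close> of computed digits stays fixed throughout; the
  shrinking part that can be trusted is expressed by the modulus.\<close>

lemma funpow_local_step_block:
  assumes "m + 2 * t * R \<le> M"
  shows "(local_step CARD('a) R G M ^^ t) (block x a M) mod CARD('a) ^ m = block ((F ^^ t) x) (a + int (t * R)) m"
  using assms
proof (induction t arbitrary: m)
  case 0
  then show ?case using block_div_mod[of 0 m M "block x a M" x a] by (simp add: block_less)
next
  case (Suc t)
  have "(local_step CARD('a) R G M ^^ t) (block x a M) mod CARD('a) ^ (m + 2 * R)
      = block ((F ^^ t) x) (a + int (t * R)) (m + 2 * R)"
    using Suc.prems by (intro Suc.IH) (simp add: algebra_simps)
  then have "local_step CARD('a) R G M ((local_step CARD('a) R G M ^^ t) (block x a M)) mod CARD('a) ^ m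
      = block (F ((F ^^ t) x)) (a + int (t * R) + int R) m"
    using Suc.prems by (intro local_step_block) auto
  then show ?case by (simp add: algebra_simps)
qed

end

section \<open>Iterated images of the initial measure and their Cesaro means\<close>

lemma pushforward_invariant:
  fixes F :: "(int \<Rightarrow> 'a::{finite,discrete_topology}) \<Rightarrow> (int \<Rightarrow> 'a)"
  assumes "cellular_automaton F" "\<mu> \<in> invariant_measures"
  shows "pushforward F \<mu> \<in> invariant_measures"
    and "E \<in> sets borel \<Longrightarrow> F -` E \<in> sets borel"
    and "E \<in> sets borel \<Longrightarrow> measure (pushforward F \<mu>) E = measure \<mu> (F -` E)"
proof -
  note inv = invariant_measuresD[OF assms(2)]
  have "continuous_on UNIV F" using assms(1) by (simp add: cellular_automaton_def)
  then have F: "F \<in> measurable borel borel" by (rule borel_measurable_continuous_onI)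
  then have F\<mu>: "F \<in> measurable \<mu> borel" using measurable_cong_sets[OF inv(2) refl] by blast
  show vE: "F -` E \<in> sets borel" if "E \<in> sets borel" for E
    using measurable_sets[OF F that] by simp
  show mE: "measure (pushforward F \<mu>) E = measure \<mu> (F -` E)" if "E \<in> sets borel" for E
    unfolding pushforward_def using measure_distr[OF F\<mu> that] by (simp add: inv)
  show "pushforward F \<mu> \<in> invariant_measures"
  proof (rule invariant_measuresI)
    show "prob_space (pushforward F \<mu>)"
      unfolding pushforward_def by (rule prob_space.prob_space_distr[OF inv(1) F\<mu>])
    fix E :: "(int \<Rightarrow> 'a) set" assume E: "E \<in> sets borel" "shift -` E \<in> sets borel"
    have "F -` (shift -` E) = shift -` (F -` E)"
      using assms(1) by (auto simp: cellular_automaton_def)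
    then show "measure (pushforward F \<mu>) (shift -` E) = measure (pushforward F \<mu>) E"
      by (simp add: mE E measure_vimage_shift[OF assms(2) vE])
  qed (simp add: pushforward_def)
qed

lemma funpow_pushforward:
  fixes F :: "(int \<Rightarrow> 'a::{finite,discrete_topology}) \<Rightarrow> (int \<Rightarrow> 'a)"
  assumes "cellular_automaton F" "\<mu> \<in> invariant_measures"
  shows "(pushforward F ^^ t) \<mu> \<in> invariant_measures"
    and "E \<in> sets borel \<Longrightarrow> measure ((pushforward F ^^ t) \<mu>) E = measure \<mu> ((F ^^ t) -` E)"
proof -
  have "(pushforward F ^^ t) \<mu> \<in> invariant_measures \<and>
    (\<forall>E\<in>sets borel. measure ((pushforward F ^^ t) \<mu>) E = measure \<mu> ((F ^^ t) -` E))"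
  proof (induction t)
    case (Suc t)
    then show ?case
      using pushforward_invariant[OF assms(1), of "(pushforward F ^^ t) \<mu>"]
      by (simp add: vimage_def)
  qed (simp add: assms)
  then show "(pushforward F ^^ t) \<mu> \<in> invariant_measures"
    and "E \<in> sets borel \<Longrightarrow> measure ((pushforward F ^^ t) \<mu>) E = measure \<mu> ((F ^^ t) -` E)" by auto
qed

text \<open>The error is counted in units of 2^-p, with one constant \<open>C\<close> for all times,
  words and precisions. Rounding and averaging only enlarge the constant. Numbers \<open>k\<close>
  from \<open>CARD('a) ^ n\<close> on code no word of length \<open>n\<close> and are left
  free.\<close>

definition uniformly_computable :: "(nat \<Rightarrow> (int \<Rightarrow> 'a::{finite,discrete_topology}) measure) \<Rightarrow> bool" where
  "uniformly_computable \<nu> \<longleftrightarrow> (\<exists>Y C.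
     computable_from [\<lambda>(t, n, k, p). t, \<lambda>(t, n, k, p). n, \<lambda>(t, n, k, p). k, \<lambda>(t, n, k, p). p]
       (\<lambda>(t, n, k, p). Y t n k p) \<and>
     (\<forall>t n k p. k < CARD('a) ^ n \<longrightarrow>
       \<bar>measure (\<nu> t) (block_set n k) * 2 ^ p - real (Y t n k p)\<bar> \<le> real C))"

lemma computable_measure_blocks:
  fixes \<mu> :: "(int \<Rightarrow> 'a::{finite,discrete_topology}) measure"
  assumes "computable_measure \<mu>"
  obtains Y where "computable_from [\<lambda>(n, k, p). n, \<lambda>(n, k, p). k, \<lambda>(n, k, p). p] (\<lambda>(n, k, p). Y n k p)"
    "\<And>n k p. k < CARD('a) ^ n \<Longrightarrow> \<bar>measure \<mu> (block_set n k) * 2 ^ p - real (Y n k p)\<bar> \<le> 2"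
proof -
  obtain f :: "'a list \<Rightarrow> nat \<Rightarrow> rat" and pr
    where pr: "\<And>u n. rec_eval pr [word_code u, n] (rat_code (f u n))"
      and f: "\<And>u n. \<bar>measure \<mu> (cylinder u) - of_rat (f u n)\<bar> < (1/2) ^ n"
    using assms unfolding computable_measure_def by blast
  define Y where "Y n k p = dyadic_approx (rat_code (f (nat_word n k) p)) p" for n k p
  let ?gs = "[\<lambda>(n, k, p). n, \<lambda>(n, k, p). k, \<lambda>(n, k, p). p] :: (nat \<times> nat \<times> nat \<Rightarrow> nat) list"
  have 1: "computable_from [\<lambda>(n, k, p). word_code (nat_word n k :: 'a list), \<lambda>(n, k, p). p]
      (\<lambda>(n, k, p). rat_code (f (nat_word n k) p))"
    unfolding computable_from_def using pr by (intro exI[of _ pr]) auto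
  have 2: "computable_from ?gs (\<lambda>(n, k, p). word_code (nat_word n k :: 'a list))"
    unfolding case_prod_unfold by (rule computable | (rule computable_from_member, simp; fail))+
  have 3: "computable_from ?gs (\<lambda>(n, k, p). rat_code (f (nat_word n k) p))"
    by (rule computable_from_trans[OF _ 1]) (use 2 in \<open>auto intro: computable_from_member\<close>)
  have "computable_from ?gs (\<lambda>(n, k, p). Y n k p)"
    using 3 unfolding case_prod_unfold Y_def
    by - (rule computable_dyadic_approx | assumption | (rule computable_from_member, simp; fail))+
  moreover have "\<bar>measure \<mu> (block_set n k) * 2 ^ p - real (Y n k p)\<bar> \<le> 2" if "k < CARD('a) ^ n" for n k p
    unfolding Y_def using f[of "nat_word n k" p]
    by (intro dyadic_approx_rat_code) (simp_all add: cylinder_nat_word that)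
  ultimately show ?thesis by (rule that)
qed

text \<open>The error of a sum of \<open>Q\<close> approximations is at most \<open>2 * Q\<close>; it becomes bounded by working
  with \<open>Q\<close> additional binary digits.\<close>

lemma uniformly_computable_funpow_pushforward:
  fixes F :: "(int \<Rightarrow> 'a::{finite,discrete_topology}) \<Rightarrow> (int \<Rightarrow> 'a)"
  assumes F: "cellular_automaton F" and \<mu>: "\<mu> \<in> invariant_measures" and comp: "computable_measure \<mu>"
  shows "uniformly_computable (\<lambda>t. (pushforward F ^^ t) \<mu>)"
proof -
  let ?q = "CARD('a)"
  obtain R :: nat and G :: "nat \<Rightarrow> nat" where "\<And>j. G j < ?q" "\<And>x i. digit (F x i) = G (block x (i - int R) (2 * R + 1))"
    by (rule cellular_automaton_local_rule[OF F]) (rule that)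
  then interpret local_rule F R G by unfold_locales
  obtain Y where Y: "computable_from [\<lambda>(n, k, p). n, \<lambda>(n, k, p). k, \<lambda>(n, k, p). p] (\<lambda>(n, k, p). Y n k p)"
    "\<And>n k p. k < ?q ^ n \<Longrightarrow> \<bar>measure \<mu> (block_set n k) * 2 ^ p - real (Y n k p)\<bar> \<le> 2"
    by (rule computable_measure_blocks[OF comp]) (rule that)
  \<comment> \<open>Each step costs \<open>2 * R\<close> digits, so \<open>n\<close> digits at time
    \<open>t\<close> require a word of length \<open>M t n\<close> at time 0.\<close>
  define M where "M t n = n + 2 * t * R" for t n
  define Z where "Z t n k p = (\<Sum>j<?q ^ M t n. of_bool ((local_step ?q R G (M t n) ^^ t) j mod ?q ^ n = k) *
    Y (M t n) j (p + ?q ^ M t n)) div 2 ^ (?q ^ M t n)" for t n k p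
  have compY: "computable_from gs (\<lambda>e. Y (a e) (b e) (c e))"
    if "computable_from gs a" "computable_from gs b" "computable_from gs c" for gs :: "('e \<Rightarrow> nat) list" and a b c
    using computable_from_reparam[OF Y(1), of "\<lambda>e. (a e, b e, c e)"] that
    by (auto intro: computable_from_trans[rotated])
  have step: "computable_from gs (\<lambda>e. (local_step ?q R G (N e) ^^ t e) (j e))"
    if "computable_from gs N" "computable_from gs t" "computable_from gs j" for gs :: "('e \<Rightarrow> nat) list" and N t j
    by (intro computable_funpow_param computable_local_step that) simp
  have "computable_from [\<lambda>(t, n, k, p). t, \<lambda>(t, n, k, p). n, \<lambda>(t, n, k, p). k, \<lambda>(t, n, k, p). p]
      (\<lambda>(t, n, k, p). Z t n k p)"
    unfolding case_prod_unfold Z_def M_def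
    by (rule computable compY step | (rule computable_from_member, simp; fail))+
  \<comment> \<open>Two units remain from the sum after the additional digits are cut off; the
    rounded division adds the third.\<close>
  moreover have "\<bar>measure ((pushforward F ^^ t) \<mu>) (block_set n k) * 2 ^ p - real (Z t n k p)\<bar> \<le> real 3"
    for t n k p
  proof -
    define m where "m = M t n"
    define Q where "Q = ?q ^ m"
    define S where "S = {j. j < Q \<and> (local_step ?q R G m ^^ t) j mod ?q ^ n = k}"
    define s where "s = (\<Sum>j\<in>S. Y m j (p + Q))"
    have S: "finite S" "card S \<le> Q" using card_mono[of "{..<Q}" S] by (auto simp: S_def)
    \<comment> \<open>The block is moved to \<open>t * R\<close>, where the iterated local step
      locates the image of the initial block at 0.\<close>
    have "measure ((pushforward F ^^ t) \<mu>) (block_set n k)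
        = measure ((pushforward F ^^ t) \<mu>) {x. block x (int (t * R)) n = k}"
      by (rule measure_block[symmetric, OF funpow_pushforward(1)[OF F \<mu>]])
    also have "\<dots> = measure \<mu> ((F ^^ t) -` {x. block x (int (t * R)) n = k})"
      by (rule funpow_pushforward(2)[OF F \<mu> block_sets])
    also have "(F ^^ t) -` {x. block x (int (t * R)) n = k} = {x. block x 0 m \<in> S}"
      using funpow_local_step_block[of n t m _ 0] block_less[where 'a='a, of _ 0 m]
      by (auto simp: S_def Q_def m_def M_def)
    also have "measure \<mu> \<dots> = (\<Sum>j\<in>S. measure \<mu> (block_set m j))"
      by (rule measure_block_in[OF \<mu> S(1)])
    finally have meas: "measure ((pushforward F ^^ t) \<mu>) (block_set n k) = (\<Sum>j\<in>S. measure \<mu> (block_set m j))" .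
    have "\<bar>(\<Sum>j\<in>S. measure \<mu> (block_set m j)) * 2 ^ (p + Q) - real s\<bar>
        \<le> (\<Sum>j\<in>S. \<bar>measure \<mu> (block_set m j) * 2 ^ (p + Q) - real (Y m j (p + Q))\<bar>)"
      unfolding s_def of_nat_sum sum_distrib_right sum_subtractf[symmetric] by (rule sum_abs)
    also have "\<dots> \<le> (\<Sum>j\<in>S. 2)" by (intro sum_mono Y(2)) (simp add: S_def Q_def)
    also have "\<dots> \<le> 2 * real Q" using S(2) by simp
    also have "\<dots> \<le> 2 * 2 ^ Q" using of_nat_less_two_power[of Q, where 'a=real] by simp
    finally have "\<bar>(\<Sum>j\<in>S. measure \<mu> (block_set m j)) * 2 ^ p * 2 ^ Q - real s\<bar> \<le> 2 * 2 ^ Q"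
      by (simp add: power_add mult.assoc)
    then have close: "\<bar>(\<Sum>j\<in>S. measure \<mu> (block_set m j)) * 2 ^ p - real s / 2 ^ Q\<bar> \<le> 2"
      by (auto simp: abs_le_iff field_simps)
    have "Z t n k p = s div 2 ^ Q"
    proof -
      have "(\<Sum>j<Q. of_bool ((local_step ?q R G m ^^ t) j mod ?q ^ n = k) * Y m j (p + Q)) = s"
        unfolding s_def by (rule sum.mono_neutral_cong_right) (auto simp: S_def)
      then show ?thesis by (simp add: Z_def m_def[symmetric] Q_def[symmetric])
    qed
    with real_div_nat_bounds[of "2 ^ Q" s] close show ?thesis unfolding meas by simp
  qed
  ultimately show ?thesis unfolding uniformly_computable_def by blast
qed

text \<open>The mean of \<open>t + 1\<close> errors bounded by \<open>C\<close> is again bounded by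
  \<open>C\<close>, so no additional digits are called for; the rounded division contributes the
  remaining unit.\<close>

lemma uniformly_computable_average:
  fixes \<nu> :: "nat \<Rightarrow> (int \<Rightarrow> 'a::{finite,discrete_topology}) measure"
  assumes "uniformly_computable \<nu>" and inv: "\<And>t. \<nu> t \<in> invariant_measures"
  shows "uniformly_computable (\<lambda>t. average_measure (t + 1) \<nu>)"
proof -
  obtain Y C where Y: "computable_from [\<lambda>(t, n, k, p). t, \<lambda>(t, n, k, p). n, \<lambda>(t, n, k, p). k, \<lambda>(t, n, k, p). p]
       (\<lambda>(t, n, k, p). Y t n k p)"
     "\<And>t n k p. k < CARD('a) ^ n \<Longrightarrow> \<bar>measure (\<nu> t) (block_set n k) * 2 ^ p - real (Y t n k p)\<bar> \<le> real C"
    using assms(1) unfolding uniformly_computable_def by blast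
  define Z where "Z t n k p = (\<Sum>s<t + 1. Y s n k p) div (t + 1)" for t n k p
  have "computable_from [\<lambda>(t, n, k, p). t, \<lambda>(t, n, k, p). n, \<lambda>(t, n, k, p). k, \<lambda>(t, n, k, p). p]
      (\<lambda>(t, n, k, p). Z t n k p)"
    unfolding case_prod_unfold Z_def
    by (rule computable computable_from_compose4[OF Y(1)] | (rule computable_from_member, simp; fail))+
  moreover have "\<bar>measure (average_measure (t + 1) \<nu>) (block_set n k) * 2 ^ p - real (Z t n k p)\<bar> \<le> real (C + 1)"
    if k: "k < CARD('a) ^ n" for t n k p
  proof -
    define T where "T = real (t + 1)"
    define s where "s = (\<Sum>s<t + 1. Y s n k p)"
    define A where "A = measure (average_measure (t + 1) \<nu>) (block_set n k)"
    have T: "T > 0" by (simp add: T_def)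
    have "A = (\<Sum>i<t + 1. measure (\<nu> i) (block_set n k)) / T"
      unfolding A_def T_def using inv invariant_measuresD
      by (intro measure_average_measure block_set_sets) auto
    then have "A * T = (\<Sum>i<t + 1. measure (\<nu> i) (block_set n k))" using T by simp
    then have "A * T * 2 ^ p = (\<Sum>i<t + 1. measure (\<nu> i) (block_set n k) * 2 ^ p)"
      by (simp only: sum_distrib_right)
    then have "A * T * 2 ^ p - real s = (\<Sum>i<t + 1. measure (\<nu> i) (block_set n k) * 2 ^ p - real (Y i n k p))"
      by (simp only: s_def sum_subtractf of_nat_sum)
    also have "\<bar>\<dots>\<bar> \<le> (\<Sum>i<t + 1. \<bar>measure (\<nu> i) (block_set n k) * 2 ^ p - real (Y i n k p)\<bar>)"
      by (rule sum_abs)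
    also have "\<dots> \<le> (\<Sum>i<t + 1. real C)" by (intro sum_mono Y(2) k)
    also have "\<dots> = real C * T" by (simp add: T_def)
    finally have "\<bar>A * 2 ^ p - real s / T\<bar> \<le> real C"
      using T by (auto simp: abs_le_iff field_simps)
    moreover have "Z t n k p = s div (t + 1)" by (simp add: Z_def s_def)
    ultimately show ?thesis
      using real_div_nat_bounds[of "t + 1" s] unfolding A_def[symmetric] T_def by simp
  qed
  ultimately show ?thesis unfolding uniformly_computable_def by blast
qed

section \<open>Deciding approximate distances\<close>

text \<open>The number of occurrences of the word with number \<open>k\<close> in the cyclic word
  with code \<open>c\<close>. Divided by the length of the period, it is the probability under the
  periodic measure.\<close>

definition periodic_count :: "'a::finite itself \<Rightarrow> nat \<Rightarrow> nat \<Rightarrow> nat \<Rightarrow> nat" where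
  "periodic_count _ c n k = (\<Sum>i<code_length c. of_bool (\<forall>j<n.
     code_nth c ((i + j) mod code_length c) = letter_code TYPE('a) (k div CARD('a) ^ j mod CARD('a))))"

lemma measure_periodic_measure_block_set:
  fixes w :: "'a::{finite,discrete_topology} list"
  assumes "w \<noteq> []" "k < CARD('a) ^ n"
  shows "measure (periodic_measure w) (block_set n k)
    = real (periodic_count TYPE('a) (word_code w) n k) / real (code_length (word_code w))"
proof -
  have len: "code_length (word_code w) = length w"
    by (simp add: word_code_def code_length_list_encode)
  have nth: "code_nth (word_code w) m = to_nat (w ! m)" if "m < length w" for m
    using that by (simp add: word_code_def code_nth_list_encode)
  have "(shift ^^ i) (periodic_config w) \<in> block_set n k \<longleftrightarrow>
      (\<forall>j<n. code_nth (word_code w) ((i + j) mod length w) = letter_code TYPE('a) (k div CARD('a) ^ j mod CARD('a)))"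
    for i
  proof -
    have "(shift ^^ i) (periodic_config w) \<in> block_set n k \<longleftrightarrow>
        block ((shift ^^ i) (periodic_config w)) 0 n = block (nat_config k :: int \<Rightarrow> 'a) 0 n"
      by (simp add: block_set_def block_nat_config[OF assms(2)])
    also have "\<dots> \<longleftrightarrow> (\<forall>j<n. w ! nat ((int j + int i) mod int (length w)) = nat_config k (int j))"
      by (simp add: block_eq_iff funpow_shift_periodic_config[OF assms(1)])
    also have "\<dots> \<longleftrightarrow> (\<forall>j<n. code_nth (word_code w) ((i + j) mod length w)
        = letter_code TYPE('a) (k div CARD('a) ^ j mod CARD('a)))"
    proof (intro all_cong1 imp_cong refl)
      fix j
      have "nat ((int j + int i) mod int (length w)) = (i + j) mod length w"
        by (metis add.commute nat_int of_nat_add zmod_int)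
      then show "w ! nat ((int j + int i) mod int (length w)) = nat_config k (int j) \<longleftrightarrow>
          code_nth (word_code w) ((i + j) mod length w) = letter_code TYPE('a) (k div CARD('a) ^ j mod CARD('a))"
        using assms(1) by (simp add: nth letter_code_def nat_config_def)
    qed
    finally show ?thesis .
  qed
  then show ?thesis
    by (simp add: measure_periodic_measure[OF assms(1) block_set_sets] periodic_count_def len)
qed

lemma computable_periodic_count [computable]:
  assumes "computable_from gs c" "computable_from gs n" "computable_from gs k"
  shows "computable_from gs (\<lambda>e. periodic_count TYPE('a::finite) (c e) (n e) (k e))"
  unfolding periodic_count_def
  by (rule computable assms | (rule computable_from_lift[OF assms(1)], force; fail) |
    (rule computable_from_lift[OF assms(2)], force; fail) |
    (rule computable_from_lift[OF assms(3)], force; fail) |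
    (rule computable_from_member, simp; fail) | (simp add: card_gt_0_iff; fail))+

definition periodic_approx :: "'a::finite itself \<Rightarrow> nat \<Rightarrow> nat \<Rightarrow> nat \<Rightarrow> nat \<Rightarrow> nat" where
  "periodic_approx T c n k p = periodic_count T c n k * 2 ^ p div code_length c"

lemma periodic_approx:
  fixes w :: "'a::{finite,discrete_topology} list"
  assumes "w \<noteq> []" "k < CARD('a) ^ n"
  shows "\<bar>measure (periodic_measure w) (block_set n k) * 2 ^ p
    - real (periodic_approx TYPE('a) (word_code w) n k p)\<bar> \<le> 1"
proof -
  have "0 < code_length (word_code w)"
    using assms(1) by (simp add: word_code_def code_length_list_encode)
  then show ?thesis
    using real_div_nat_bounds[of "code_length (word_code w)" "periodic_count TYPE('a) (word_code w) n k * 2 ^ p"]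
    by (simp add: measure_periodic_measure_block_set[OF assms] periodic_approx_def)
qed

definition nat_dist :: "nat \<Rightarrow> nat \<Rightarrow> nat" where
  "nat_dist a b = (a - b) + (b - a)"

lemma real_nat_dist: "real (nat_dist a b) = \<bar>real a - real b\<bar>"
  by (auto simp: nat_dist_def)

text \<open>A maximum moves by no more than the largest change among its entries, so the two error
  bounds simply add, independently of the number of blocks.\<close>

lemma block_dist_approx:
  fixes \<mu> :: "(int \<Rightarrow> 'a::{finite,discrete_topology}) measure"
  assumes "\<And>k. k < CARD('a) ^ n \<Longrightarrow> \<bar>measure \<mu> (block_set n k) * s - real (X k)\<bar> \<le> b"
    and "\<And>k. k < CARD('a) ^ n \<Longrightarrow> \<bar>measure \<nu> (block_set n k) * s - real (Y k)\<bar> \<le> c"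
    and s: "0 < s"
  shows "\<bar>block_dist n \<mu> \<nu> * s - real (MAX k\<in>{..<CARD('a) ^ n}. nat_dist (X k) (Y k))\<bar> \<le> b + c"
proof -
  define m where "m = (MAX k\<in>{..<CARD('a) ^ n}. nat_dist (X k) (Y k))"
  let ?d = "\<lambda>k. \<bar>measure \<mu> (block_set n k) - measure \<nu> (block_set n k)\<bar>"
  have close: "\<bar>?d k * s - real (nat_dist (X k) (Y k))\<bar> \<le> b + c" if "k < CARD('a) ^ n" for k
  proof -
    have "?d k * s = \<bar>measure \<mu> (block_set n k) * s - measure \<nu> (block_set n k) * s\<bar>"
      using s by (simp add: abs_mult flip: left_diff_distrib)
    then show ?thesis using assms(1,2)[OF that] unfolding real_nat_dist by linarith
  qed
  have ne: "{..<CARD('a) ^ n} \<noteq> {}" using card_power_pos[where 'a='a, of n] by blast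
  have "m \<in> (\<lambda>k. nat_dist (X k) (Y k)) ` {..<CARD('a) ^ n}"
    unfolding m_def using ne by (intro Max_in) auto
  then obtain k where k: "k < CARD('a) ^ n" "m = nat_dist (X k) (Y k)" by auto
  have "real m \<le> ?d k * s + (b + c)" using close[OF k(1)] k(2) by linarith
  also have "?d k * s \<le> block_dist n \<mu> \<nu> * s"
    using s by (intro mult_right_mono block_set_dist_le) auto
  finally have upper: "real m \<le> block_dist n \<mu> \<nu> * s + (b + c)" by simp
  have "block_dist n \<mu> \<nu> \<le> (real m + (b + c)) / s"
  proof (rule block_dist_leI)
    fix k assume k: "k < CARD('a) ^ n"
    then have "nat_dist (X k) (Y k) \<le> m" unfolding m_def by (intro Max_ge) auto
    then have "?d k * s \<le> real m + (b + c)" using close[OF k] by linarith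
    then show "?d k \<le> (real m + (b + c)) / s" using s by (simp add: field_simps)
  qed
  then have "block_dist n \<mu> \<nu> * s \<le> real m + (b + c)" using s by (simp add: field_simps)
  with upper show ?thesis unfolding m_def[symmetric] by linarith
qed

text \<open>The scaling factor is \<open>4 ^ i\<close>: a factor \<open>2 ^ i\<close> from the precision of the approximations, and
  another one that makes the weights \<open>(1/2) ^ n\<close> integral.\<close>

definition dist_approx ::
  "'a::finite itself \<Rightarrow> (nat \<Rightarrow> nat \<Rightarrow> nat \<Rightarrow> nat \<Rightarrow> nat) \<Rightarrow> nat \<Rightarrow> nat \<Rightarrow> nat \<Rightarrow> nat" where
  "dist_approx T Y c t i = (\<Sum>n<i. 2 ^ (i - n) *
     (MAX k\<in>{..<CARD('a) ^ n}. nat_dist (periodic_approx T c n k i) (Y t n k i)))"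

text \<open>Each block distance is off by at most \<open>1 + C\<close> units, 1 from the periodic
  measure and \<open>C\<close> from \<open>Y\<close>. The weights sum to less than 2, which gives
  \<open>2 * (1 + C)\<close>, and the truncation of the series adds 2.\<close>

lemma dist_approx:
  fixes w :: "'a::{finite,discrete_topology} list"
  assumes "w \<noteq> []" "prob_space \<nu>"
    and Y: "\<And>n k p. k < CARD('a) ^ n \<Longrightarrow> \<bar>measure \<nu> (block_set n k) * 2 ^ p - real (Y t n k p)\<bar> \<le> C"
  shows "\<bar>real (dist_approx TYPE('a) Y (word_code w) t i) / 4 ^ i - measure_dist (periodic_measure w) \<nu>\<bar>
    \<le> (2 * C + 4) / 2 ^ i"
proof -
  let ?\<delta> = "periodic_measure w"
  define m where "m n = (MAX k\<in>{..<CARD('a) ^ n}. nat_dist (periodic_approx TYPE('a) (word_code w) n k i) (Y t n k i))" for n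
  note prob = invariant_measuresD(1)[OF periodic_measure_invariant[OF assms(1)]] assms(2)
  have m: "\<bar>block_dist n ?\<delta> \<nu> * 2 ^ i - real (m n)\<bar> \<le> 1 + C" for n
    unfolding m_def by (intro block_dist_approx periodic_approx assms(1) Y) auto
  have C: "0 \<le> 1 + C" using m[of 0] by linarith
  have "real (2 ^ (i - n) * m n) / 4 ^ i = (1/2) ^ n * (real (m n) / 2 ^ i)" if "n < i" for n
  proof -
    have "(4 :: real) ^ i = 2 ^ i * 2 ^ i" by (simp flip: power_mult_distrib)
    moreover have "(2 :: real) ^ i = 2 ^ n * 2 ^ (i - n)" using that by (simp flip: power_add)
    ultimately show ?thesis by (simp add: field_simps)
  qed
  then have "real (dist_approx TYPE('a) Y (word_code w) t i) / 4 ^ i = (\<Sum>n<i. (1/2) ^ n * (real (m n) / 2 ^ i))"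
    by (simp add: dist_approx_def m_def[symmetric] sum_divide_distrib)
  then have "\<bar>(\<Sum>n<i. (1/2) ^ n * block_dist n ?\<delta> \<nu>) - real (dist_approx TYPE('a) Y (word_code w) t i) / 4 ^ i\<bar>
      = \<bar>\<Sum>n<i. (1/2) ^ n * (block_dist n ?\<delta> \<nu> - real (m n) / 2 ^ i)\<bar>"
    by (simp add: sum_subtractf right_diff_distrib)
  also have "\<dots> \<le> (\<Sum>n<i. \<bar>(1/2) ^ n * (block_dist n ?\<delta> \<nu> - real (m n) / 2 ^ i)\<bar>)"
    by (rule sum_abs)
  also have "\<dots> \<le> (\<Sum>n<i. (1/2) ^ n * ((1 + C) / 2 ^ i))"
  proof (rule sum_mono)
    fix n
    have "\<bar>block_dist n ?\<delta> \<nu> - real (m n) / 2 ^ i\<bar> \<le> (1 + C) / 2 ^ i"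
      using m[of n] by (auto simp: abs_le_iff field_simps)
    then show "\<bar>(1/2) ^ n * (block_dist n ?\<delta> \<nu> - real (m n) / 2 ^ i)\<bar> \<le> (1/2) ^ n * ((1 + C) / 2 ^ i)"
      unfolding abs_mult by (intro mult_mono) auto
  qed
  also have "\<dots> = (2 - 2 * (1/2) ^ i) * ((1 + C) / 2 ^ i)"
  proof -
    have "(\<Sum>n<i. (1/2) ^ n) = 2 - 2 * (1/2 :: real) ^ i" by (induction i) auto
    then show ?thesis by (simp only: sum_distrib_right[symmetric])
  qed
  also have "\<dots> \<le> 2 * ((1 + C) / 2 ^ i)" using C by (intro mult_right_mono) auto
  finally have "\<bar>(\<Sum>n<i. (1/2) ^ n * block_dist n ?\<delta> \<nu>) - real (dist_approx TYPE('a) Y (word_code w) t i) / 4 ^ i\<bar>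
      \<le> 2 * ((1 + C) / 2 ^ i)" .
  moreover have "(2 * C + 4) / 2 ^ i = 2 * ((1 + C) / 2 ^ i) + 2 * (1/2) ^ i"
    by (simp add: field_simps power_divide)
  ultimately show ?thesis using measure_dist_truncate[OF prob, of i] by linarith
qed

text \<open>The approximate distance is compared with the radius plus twice the error
  \<open>(2 * C + 4) / 2 ^ i\<close>. Everything is multiplied by \<open>4 ^ i\<close> and by the
  denominator of the radius, which turns the slack into \<open>(4 * C + 8) * 2 ^ i\<close>
  denominators. The parity condition says that the radius is nonnegative, and code 0 is the empty
  word. Having \<open>i \<le> t\<close> inside the test lets \<open>t\<close> range over all
  numbers.\<close>

definition ball_test :: "'a::finite itself \<Rightarrow> (nat \<Rightarrow> nat \<Rightarrow> nat \<Rightarrow> nat \<Rightarrow> nat) \<Rightarrow> nat \<Rightarrow> nat \<Rightarrow> nat \<Rightarrow> nat \<Rightarrow> nat \<Rightarrow> bool" where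
  "ball_test T Y C i t c r \<longleftrightarrow> c \<noteq> 0 \<and> i \<le> t \<and> fst (prod_decode r) mod 2 = 0 \<and>
     dist_approx T Y c t i * snd (prod_decode r)
       \<le> fst (prod_decode r) div 2 * 4 ^ i + (4 * C + 8) * 2 ^ i * snd (prod_decode r)"

lemma ball_test_iff:
  fixes w :: "'a::{finite,discrete_topology} list"
  shows "ball_test TYPE('a) Y C i t (word_code w) (rat_code r) \<longleftrightarrow> w \<noteq> [] \<and> 0 \<le> r \<and> i \<le> t \<and>
    real (dist_approx TYPE('a) Y (word_code w) t i) / 4 ^ i \<le> of_rat r + 2 * ((2 * real C + 4) / 2 ^ i)"
proof -
  obtain A B where AB: "0 < B" "snd (prod_decode (rat_code r)) = B"
    "fst (prod_decode (rat_code r)) mod 2 = 0 \<longleftrightarrow> 0 \<le> r"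
    "0 \<le> r \<longrightarrow> fst (prod_decode (rat_code r)) div 2 = A \<and> of_rat r = real A / real B"
    using rat_code_components[of r] .
  have code: "word_code w \<noteq> 0 \<longleftrightarrow> w \<noteq> []" by (cases w) (auto simp: word_code_def)
  let ?D = "dist_approx TYPE('a) Y (word_code w) t i"
  have "?D * B \<le> A * 4 ^ i + (4 * C + 8) * 2 ^ i * B \<longleftrightarrow>
      real ?D / 4 ^ i \<le> real A / real B + 2 * ((2 * real C + 4) / 2 ^ i)"
  proof -
    have "?D * B \<le> A * 4 ^ i + (4 * C + 8) * 2 ^ i * B \<longleftrightarrow>
        real ?D * real B \<le> real A * 4 ^ i + (4 * real C + 8) * 2 ^ i * real B"
      unfolding of_nat_le_iff[where 'a=real, symmetric] by simp
    also have "\<dots> \<longleftrightarrow> real ?D \<le> (real A * 4 ^ i + (4 * real C + 8) * 2 ^ i * real B) / real B"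
      using AB(1) by (simp add: pos_le_divide_eq)
    also have "(real A * 4 ^ i + (4 * real C + 8) * 2 ^ i * real B) / real B
        = (real A / real B + 2 * ((2 * real C + 4) / 2 ^ i)) * 4 ^ i"
    proof -
      have "(4 :: real) ^ i = 2 ^ i * 2 ^ i" by (simp flip: power_mult_distrib)
      then show ?thesis using AB(1) by (simp add: field_simps)
    qed
    finally show ?thesis by (simp add: pos_divide_le_eq)
  qed
  then show ?thesis using AB code by (auto simp: ball_test_def)
qed

lemma computable_ball_test:
  assumes Y: "computable_from [\<lambda>(t, n, k, p). t, \<lambda>(t, n, k, p). n, \<lambda>(t, n, k, p). k, \<lambda>(t, n, k, p). p]
    (\<lambda>(t, n, k, p). Y t n k p)"
  shows "computable_from [\<lambda>(i, j, w, r). i, \<lambda>(i, j, w, r). j, \<lambda>(i, j, w, r). w, \<lambda>(i, j, w, r). r]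
    (\<lambda>(i, j, w, r). of_bool (ball_test TYPE('a::finite) Y C i j w r))"
  unfolding case_prod_unfold ball_test_def dist_approx_def nat_dist_def periodic_approx_def
  by (rule computable computable_from_compose4[OF Y] | (rule computable_from_member, simp; fail) |
    (simp add: card_power_pos; fail))+

text \<open>Orbits of measures and their Cesaro means are both uniformly computable sequences of
  invariant measures, so one argument serves both limit sets. The precision becomes the index of the
  infimum and the time that of the supremum.\<close>

theorem limit_points_Pi2_computable:
  fixes \<nu> :: "nat \<Rightarrow> (int \<Rightarrow> 'a::{finite,discrete_topology}) measure"
  assumes inv: "\<And>t. \<nu> t \<in> invariant_measures" and unif: "uniformly_computable \<nu>"
  defines "K \<equiv> sequence_limit_points weak_star \<nu>"
  shows "K \<noteq> {} \<and> compactin weak_star K \<and> Pi2_computable K"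
proof -
  have range: "range \<nu> \<subseteq> invariant_measures" using inv by blast
  note compact = compact_space_invariant_measures[where 'a='a]
  have K: "K = sequence_limit_points invariant_measures.mtopology \<nu>"
    unfolding K_def weak_star_eq_mtopology ..
  have closed: "closedin weak_star K"
    unfolding K weak_star_eq_mtopology by (rule invariant_measures.closedin_sequence_limit_points[OF range])
  have sub: "K \<subseteq> invariant_measures" using closedin_subset[OF closed] by simp
  obtain Y C where Y: "computable_from [\<lambda>(t, n, k, p). t, \<lambda>(t, n, k, p). n, \<lambda>(t, n, k, p). k, \<lambda>(t, n, k, p). p]
       (\<lambda>(t, n, k, p). Y t n k p)"
     "\<And>t n k p. k < CARD('a) ^ n \<Longrightarrow> \<bar>measure (\<nu> t) (block_set n k) * 2 ^ p - real (Y t n k p)\<bar> \<le> real C"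
    using unif unfolding uniformly_computable_def by blast
  define P where "P i t w r \<longleftrightarrow> ball_test TYPE('a) Y C i t (word_code w) (rat_code r)"
    for i t and w :: "'a list" and r
  have hits: "(w, r) \<in> ball_hits K \<longleftrightarrow> (\<forall>i. \<exists>t. P i t w r)" for w r
  \<comment> \<open>The metric criterion needs a genuine periodic measure as centre, and the coded
    comparison a nonnegative radius. Otherwise both sides are false, because a ball of negative
    radius is empty.\<close>
  proof (cases "w \<noteq> [] \<and> 0 \<le> r")
    case True
    define D where "D i t = real (dist_approx TYPE('a) Y (word_code w) t i) / 4 ^ i" for i t
    define e where "e i = (2 * real C + 4) / 2 ^ i" for i :: nat
    have w: "w \<noteq> []" and c: "periodic_measure w \<in> invariant_measures"
      using True periodic_measure_invariant by auto
    have dist: "\<bar>measure_dist (periodic_measure w) \<rho>\<bar> = measure_dist (periodic_measure w) \<rho>"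
      if "\<rho> \<in> invariant_measures" for \<rho>
      using measure_dist_nonneg[OF c[THEN invariant_measuresD(1)] that[THEN invariant_measuresD(1)]] by simp
    have "(w, r) \<in> ball_hits K \<longleftrightarrow> (\<exists>l\<in>K. \<bar>measure_dist (periodic_measure w) l\<bar> \<le> of_rat r)"
      using w sub dist by (fastforce simp: ball_hits_def)
    also have "\<dots> \<longleftrightarrow> (\<forall>i. \<exists>t\<ge>i. D i t \<le> of_rat r + 2 * e i)"
      unfolding K
    proof (rule invariant_measures.sequence_limit_points_meet_cball_iff[OF compact range c])
      show "0 < e i" for i by (simp add: e_def add_nonneg_pos)
      show "e \<longlonglongrightarrow> 0" unfolding e_def
        by (rule LIMSEQ_divide_realpow_zero) simp
      show "\<bar>D i t - \<bar>measure_dist (periodic_measure w) (\<nu> t)\<bar>\<bar> \<le> e i" for i t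
        unfolding D_def e_def dist[OF inv]
        by (rule dist_approx[OF w invariant_measuresD(1)[OF inv] Y(2)])
    qed
    also have "\<dots> \<longleftrightarrow> (\<forall>i. \<exists>t. P i t w r)"
      using True by (simp add: P_def ball_test_iff D_def e_def)
    finally show ?thesis .
  next
    case False
    have "(w, r) \<notin> ball_hits K"
    proof
      assume "(w, r) \<in> ball_hits K"
      then obtain \<rho> where w: "w \<noteq> []" and \<rho>: "\<rho> \<in> invariant_measures"
          "measure_dist (periodic_measure w) \<rho> \<le> of_rat r"
        by (auto simp: ball_hits_def)
      have "0 \<le> measure_dist (periodic_measure w) \<rho>"
        by (intro measure_dist_nonneg invariant_measuresD(1) periodic_measure_invariant w \<rho>(1))
      then have "0 \<le> (of_rat r :: real)" using \<rho>(2) by linarith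
      then show False using False w by simp
    qed
    moreover have "\<not> P i t w r" for i t using False by (auto simp: P_def ball_test_iff)
    ultimately show ?thesis by blast
  qed
  \<comment> \<open>With values 0 and 1, a supremum is an existential quantifier and an infimum a
    universal one. Both are attained, so the extended reals introduce no further values.\<close>
  define f :: "nat \<Rightarrow> nat \<Rightarrow> 'a list \<Rightarrow> rat \<Rightarrow> rat" where "f i j w r = of_bool (P i j w r)" for i j w r
  have "\<exists>p. \<forall>i j w r. rec_eval p [i, j, word_code w, rat_code r] (rat_code (f i j w r))"
  proof -
    let ?gs = "[\<lambda>(i, j, w, r). i, \<lambda>(i, j, w, r). j, \<lambda>(i, j, w, r). word_code w, \<lambda>(i, j, w, r). rat_code r]
      :: (nat \<times> nat \<times> 'a list \<times> rat \<Rightarrow> nat) list"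
    have test: "computable_from ?gs (\<lambda>(i, j, w, r). of_bool (P i j w r))"
      unfolding case_prod_unfold P_def
      by (rule computable_from_compose4[OF computable_ball_test[OF Y(1)]])
        (rule computable_from_member, simp)+
    have "computable_from ?gs (\<lambda>(i, j, w, r). if P i j w r then rat_code 1 else rat_code 0)"
      using test unfolding case_prod_unfold by (rule computable_if) (rule computable_const)+
    then have "computable_from ?gs (\<lambda>(i, j, w, r). rat_code (f i j w r))"
      by (rule back_subst[where P = "computable_from ?gs"]) (auto simp: f_def)
    then show ?thesis unfolding computable_from_def by fastforce
  qed
  moreover have "indicator (ball_hits K) (w, r) = (INF i. SUP j. ereal (of_rat (f i j w r)))" for w r
  proof -
    have sup: "(SUP j. ereal (of_rat (f i j w r))) = (if \<exists>j. P i j w r then 1 else 0)" for i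
    proof (cases "\<exists>j. P i j w r")
      case True
      then obtain j where "P i j w r" by blast
      then have "(SUP j. ereal (of_rat (f i j w r))) = 1"
        by (intro antisym SUP_least SUP_upper2[of j]) (auto simp: f_def)
      with True show ?thesis by simp
    next
      case False
      then show ?thesis by (simp add: f_def)
    qed
    have "(INF i. SUP j. ereal (of_rat (f i j w r))) = (if \<forall>i. \<exists>j. P i j w r then 1 else 0)"
    proof (cases "\<forall>i. \<exists>j. P i j w r")
      case True
      then show ?thesis by (simp add: sup)
    next
      case False
      then obtain i where "\<not> (\<exists>j. P i j w r)" by blast
      then have "(INF i. SUP j. ereal (of_rat (f i j w r))) = 0"
        unfolding sup by (intro antisym INF_greatest INF_lower2[of i]) auto
      with False show ?thesis by simp
    qed
    then show ?thesis using hits[of w r] by (simp add: indicator_def)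
  qed
  ultimately have "Pi2_computable K" unfolding Pi2_computable_def using closed by blast
  moreover have "K \<noteq> {}"
    unfolding K by (rule invariant_measures.sequence_limit_points_nonempty[OF compact range])
  moreover have "compactin weak_star K"
    using compact closed unfolding weak_star_eq_mtopology by (rule closedin_compact_space)
  ultimately show ?thesis by blast
qed

theorem proposition5:
  fixes F :: "(int \<Rightarrow> 'a::{finite,discrete_topology}) \<Rightarrow> (int \<Rightarrow> 'a)"
    and \<mu> :: "(int \<Rightarrow> 'a) measure"
  assumes "cellular_automaton F"
    and "\<mu> \<in> invariant_measures"
    and "computable_measure \<mu>"
  shows "(limit_measures F \<mu> \<noteq> {} \<and> compactin weak_star (limit_measures F \<mu>) \<and>
            Pi2_computable (limit_measures F \<mu>)) \<and>
         (cesaro_limit_measures F \<mu> \<noteq> {} \<and> compactin weak_star (cesaro_limit_measures F \<mu>) \<and>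
            Pi2_computable (cesaro_limit_measures F \<mu>))"
proof
  note inv = funpow_pushforward(1)[OF assms(1,2)]
  note unif = uniformly_computable_funpow_pushforward[OF assms]
  show "limit_measures F \<mu> \<noteq> {} \<and> compactin weak_star (limit_measures F \<mu>) \<and>
      Pi2_computable (limit_measures F \<mu>)"
    unfolding limit_measures_def by (rule limit_points_Pi2_computable[OF inv unif])
  show "cesaro_limit_measures F \<mu> \<noteq> {} \<and> compactin weak_star (cesaro_limit_measures F \<mu>) \<and>
      Pi2_computable (cesaro_limit_measures F \<mu>)"
    unfolding cesaro_limit_measures_def
    by (intro limit_points_Pi2_computable average_measure_invariant inv
      uniformly_computable_average[OF unif]) simp
qed

end
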